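(* Let $n,m\ge 1$ and let $S=\mathrm{SING}_{n,m}\subseteq V=\mathrm{Mat}_n^m$. Then the connected group of symmetries $\mathcal{G}_S^\circ$ is the subgroup $G_{n,m}$ of $\mathrm{GL}(V)$.
   Context: The ground field is $\mathbb{C}$. $\mathrm{Mat}_n^m$ is the space of $m$-tuples of $n\times n$ complex matrices, and $\mathrm{SING}_{n,m}=\{(X_1,\dots,X_m)\in\mathrm{Mat}_n^m : \sum_{i} t_iX_i \text{ is singular over } \mathbb{C}(t_1,\dots,t_m)\}$, where $t_1,\dots,t_m$ are indeterminates. For a subvariety (Zariski closed subset, not necessarily irreducible) $S$ of a vector space $V$, its group of symmetries is $\mathcal{G}_S=\{g\in\mathrm{GL}(V) : gS=S\}$, an algebraic subgroup of $\mathrm{GL}(V)$. Its identity component $\mathcal{G}_S^\circ$ is called the connected group of symmetries. The group $\mathrm{GL}_m\times\mathrm{GL}_n\times\mathrm{GL}_n$ acts linearly on $\mathrm{Mat}_n^m\cong\mathbb{C}^m\otimes\mathbb{C}^n\otimes\mathbb{C}^n$ by $$(P,Q,R)\cdot(X_1,\dots,X_m)=\Big(\sum_{j=1}^m p_{1j}QX_jR^{-1},\ \sum_{j=1}^m p_{2j}QX_jR^{-1},\ \dots,\ \sum_{j=1}^m p_{mj}QX_jR^{-1}\Big),$$ where $p_{ij}$ is the $(i,j)$ entry of $P$. $G_{n,m}$ denotes the image of the resulting homomorphism $\mathrm{GL}_m\times\mathrm{GL}_n\times\mathrm{GL}_n\to\mathrm{GL}(\mathrm{Mat}_n^m)$.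 *)

theory Defs
  imports
    "HOL-Analysis.Analysis"
    "HOL-Library.Poly_Mapping"
    "HOL-Computational_Algebra.Fraction_Field"
begin

section \<open>GL(V) as an algebraic group, and groups of symmetries\<close>

text \<open>A complex vector space V is given by a type together with its scalar multiplication
  \<open>scl\<close>, in the style of \<^theory>\<open>HOL.Vector_Spaces\<close>.\<close>

definition general_linear :: "(complex \<Rightarrow> 'v \<Rightarrow> 'v) \<Rightarrow> ('v::ab_group_add \<Rightarrow> 'v) set"
  where "general_linear scl = {g. Vector_Spaces.linear scl scl g \<and> bij g}"

text \<open>Polynomial functions on End(V): the algebra of functions generated by the constants and the
  matrix coefficients \<open>g \<mapsto> \<phi> (g v)\<close>. For finite-dimensional V the matrix coefficients span the
  dual space of End(V), so these are exactly the polynomials in the entries of a matrix of g.\<close>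

inductive_set polynomial_functions_End ::
    "(complex \<Rightarrow> 'v \<Rightarrow> 'v) \<Rightarrow> (('v::ab_group_add \<Rightarrow> 'v) \<Rightarrow> complex) set"
  for scl :: "complex \<Rightarrow> 'v \<Rightarrow> 'v"
  where
    const: "(\<lambda>g. c) \<in> polynomial_functions_End scl"
  | coeff: "Vector_Spaces.linear scl (*) \<phi> \<Longrightarrow> (\<lambda>g. \<phi> (g v)) \<in> polynomial_functions_End scl"
  | add: "p \<in> polynomial_functions_End scl \<Longrightarrow> q \<in> polynomial_functions_End scl \<Longrightarrow>
      (\<lambda>g. p g + q g) \<in> polynomial_functions_End scl"
  | mult: "p \<in> polynomial_functions_End scl \<Longrightarrow> q \<in> polynomial_functions_End scl \<Longrightarrow>
      (\<lambda>g. p g * q g) \<in> polynomial_functions_End scl"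

text \<open>The closed subsets of GL(V) are the zero loci in GL(V) of sets of polynomial functions on
  End(V). Since GL(V) is a principal open subset of End(V), admitting the inverse of the
  determinant as a further regular function would give the same closed sets.\<close>

definition zariski_closed_GL :: "(complex \<Rightarrow> 'v \<Rightarrow> 'v) \<Rightarrow> ('v::ab_group_add \<Rightarrow> 'v) set \<Rightarrow> bool"
  where "zariski_closed_GL scl C \<longleftrightarrow>
    (\<exists>F \<subseteq> polynomial_functions_End scl. C = {g \<in> general_linear scl. \<forall>f\<in>F. f g = 0})"

definition zariski_GL :: "(complex \<Rightarrow> 'v \<Rightarrow> 'v) \<Rightarrow> ('v::ab_group_add \<Rightarrow> 'v) topology"
  where "zariski_GL scl = topology (\<lambda>U. U \<subseteq> general_linear scl \<and>
    zariski_closed_GL scl (general_linear scl - U))"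

lemma istopology_zariski_GL:
  "istopology (\<lambda>U. U \<subseteq> general_linear scl \<and> zariski_closed_GL scl (general_linear scl - U))"
proof (unfold istopology_def, intro conjI allI impI; (elim conjE)?)
  let ?G = "general_linear scl" and ?P = "polynomial_functions_End scl"
  fix U W assume U: "U \<subseteq> ?G" "zariski_closed_GL scl (?G - U)"
    and W: "W \<subseteq> ?G" "zariski_closed_GL scl (?G - W)"
  show "U \<inter> W \<subseteq> ?G" using U by auto
  obtain E where E: "E \<subseteq> ?P" "?G - U = {g\<in>?G. \<forall>f\<in>E. f g = 0}"
    using U(2) unfolding zariski_closed_GL_def by blast
  obtain F where F: "F \<subseteq> ?P" "?G - W = {g\<in>?G. \<forall>f\<in>F. f g = 0}"
    using W(2) unfolding zariski_closed_GL_def by blast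
  let ?H = "(\<lambda>(e, f) g. e g * f g) ` (E \<times> F)"
  have "?H \<subseteq> ?P"
    using E(1) F(1) by (auto simp: subset_iff intro!: polynomial_functions_End.mult)
  moreover have "?G - U \<inter> W = {g\<in>?G. \<forall>h\<in>?H. h g = 0}"
  proof -
    have "?G - U \<inter> W = (?G - U) \<union> (?G - W)" by (simp add: Diff_Int)
    also have "\<dots> = {g\<in>?G. \<forall>h\<in>?H. h g = 0}"
      unfolding E(2) F(2) by (simp add: set_eq_iff) metis
    finally show ?thesis .
  qed
  ultimately show "zariski_closed_GL scl (?G - U \<inter> W)"
    unfolding zariski_closed_GL_def by (intro exI[of _ ?H] conjI)
next
  let ?G = "general_linear scl" and ?P = "polynomial_functions_End scl"
  fix K assume K: "\<forall>U\<in>K. U \<subseteq> ?G \<and> zariski_closed_GL scl (?G - U)"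
  show "\<Union>K \<subseteq> ?G" using K by blast
  have "\<forall>U\<in>K. \<exists>F. F \<subseteq> ?P \<and> ?G - U = {g\<in>?G. \<forall>f\<in>F. f g = 0}"
    using K unfolding zariski_closed_GL_def by blast
  then have "\<exists>F. \<forall>U\<in>K. F U \<subseteq> ?P \<and> ?G - U = {g\<in>?G. \<forall>f\<in>F U. f g = 0}"
    by (rule bchoice)
  then obtain F where F: "\<forall>U\<in>K. F U \<subseteq> ?P \<and> ?G - U = {g\<in>?G. \<forall>f\<in>F U. f g = 0}" ..
  let ?H = "\<Union>(F ` K)"
  have mem: "g \<in> ?G - U \<longleftrightarrow> g \<in> ?G \<and> (\<forall>f\<in>F U. f g = 0)" if "U \<in> K" for g U
    using bspec[OF F that, THEN conjunct2, THEN eqset_imp_iff, of g] by simp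
  have "g \<in> ?G - \<Union>K \<longleftrightarrow> g \<in> {g\<in>?G. \<forall>f\<in>?H. f g = 0}" for g
  proof -
    have "g \<in> ?G - \<Union>K \<longleftrightarrow> g \<in> ?G \<and> (\<forall>U\<in>K. g \<in> ?G - U)" by auto
    also have "\<dots> \<longleftrightarrow> g \<in> ?G \<and> (\<forall>U\<in>K. \<forall>f\<in>F U. f g = 0)"
      using mem by (metis (full_types))
    finally show ?thesis by simp
  qed
  then have "?G - \<Union>K = {g\<in>?G. \<forall>f\<in>?H. f g = 0}" by (rule set_eqI)
  moreover have "?H \<subseteq> ?P" using F by (intro UN_least) simp
  ultimately show "zariski_closed_GL scl (?G - \<Union>K)"
    unfolding zariski_closed_GL_def by (intro exI[of _ ?H] conjI)
qed

lemma openin_zariski_GL: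
  "openin (zariski_GL scl) U \<longleftrightarrow>
    U \<subseteq> general_linear scl \<and> zariski_closed_GL scl (general_linear scl - U)"
  unfolding zariski_GL_def by (simp add: topology_inverse'[OF istopology_zariski_GL])

lemma topspace_zariski_GL: "topspace (zariski_GL scl) = general_linear scl"
proof -
  have "(\<lambda>g. 1) \<in> polynomial_functions_End scl" by (rule polynomial_functions_End.const)
  then have "zariski_closed_GL scl {}"
    unfolding zariski_closed_GL_def by (intro exI[of _ "{\<lambda>g. 1}"]) auto
  then have "openin (zariski_GL scl) (general_linear scl)"
    by (simp add: openin_zariski_GL)
  moreover have "topspace (zariski_GL scl) \<subseteq> general_linear scl"
    using openin_topspace[of "zariski_GL scl"] unfolding openin_zariski_GL by blast
  ultimately show ?thesis by (simp add: openin_subset subset_antisym)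
qed

lemma closedin_zariski_GL: "closedin (zariski_GL scl) C \<longleftrightarrow> zariski_closed_GL scl C"
proof -
  have "C \<subseteq> general_linear scl" if "zariski_closed_GL scl C"
    using that unfolding zariski_closed_GL_def by blast
  then show ?thesis
    by (auto simp: closedin_def topspace_zariski_GL openin_zariski_GL double_diff)
qed

definition symmetry_group :: "(complex \<Rightarrow> 'v \<Rightarrow> 'v) \<Rightarrow> 'v set \<Rightarrow> ('v::ab_group_add \<Rightarrow> 'v) set"
  where "symmetry_group scl S = {g \<in> general_linear scl. g ` S = S}"

definition connected_symmetry_group ::
    "(complex \<Rightarrow> 'v \<Rightarrow> 'v) \<Rightarrow> 'v set \<Rightarrow> ('v::ab_group_add \<Rightarrow> 'v) set"
  where "connected_symmetry_group scl S =
    connected_component_of_set (subtopology (zariski_GL scl) (symmetry_group scl S)) id"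

section \<open>Tuples of matrices\<close>

text \<open>An m-tuple X of n by n matrices has type \<open>complex^'n^'n^'m\<close>, with \<open>X $ i\<close> its i-th matrix.\<close>

definition tuple_scale :: "complex \<Rightarrow> complex^'n^'n^'m \<Rightarrow> complex^'n^'n^'m"
  where "tuple_scale c X = (\<chi> i. map_matrix ((*) c) (X $ i))"

lemma vector_space_tuple_scale: "vector_space tuple_scale"
  by unfold_locales (simp_all add: tuple_scale_def vec_eq_iff algebra_simps)

text \<open>\<open>('m \<Rightarrow>\<^sub>0 nat) \<Rightarrow>\<^sub>0 complex\<close> is the ring of polynomials in the indeterminates \<open>t\<^sub>i\<close>,
  i ranging over \<open>'m\<close>, as finitely supported functions from exponent vectors to coefficients. The
  order on \<open>'m\<close> is only there because the library's \<^class>\<open>idom\<close> instance asks for it.\<close>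

type_synonym 'm ratfun = "(('m \<Rightarrow>\<^sub>0 nat) \<Rightarrow>\<^sub>0 complex) fract"

definition ratfun_const :: "complex \<Rightarrow> 'm::linorder ratfun"
  where "ratfun_const c = Fract (Poly_Mapping.single 0 c) 1"

definition ratfun_var :: "'m::linorder \<Rightarrow> 'm ratfun"
  where "ratfun_var i = Fract (Poly_Mapping.single (Poly_Mapping.single i 1) 1) 1"

definition generic_combination ::
    "complex^'n^'n^'m::{finite,linorder} \<Rightarrow> ('m ratfun)^'n^'n"
  where "generic_combination X =
    (\<Sum>i\<in>UNIV. map_matrix (\<lambda>x. ratfun_var i * ratfun_const x) (X $ i))"

definition SING :: "(complex^'n^'n^'m::{finite,linorder}) set"
  where "SING = {X. \<not> invertible (generic_combination X)}"

definition tuple_action ::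
    "complex^'m^'m \<Rightarrow> complex^'n^'n \<Rightarrow> complex^'n^'n \<Rightarrow> complex^'n^'n^'m \<Rightarrow> complex^'n^'n^'m"
  where "tuple_action P Q R X =
    (\<chi> i. \<Sum>j\<in>UNIV. map_matrix ((*) (P $ i $ j)) (Q ** X $ j ** matrix_inv R))"

definition tuple_action_group :: "(complex^'n^'n^'m \<Rightarrow> complex^'n^'n^'m) set"
  where "tuple_action_group =
    {tuple_action P Q R | P Q R. invertible P \<and> invertible Q \<and> invertible R}"

end

theory Submission
  imports Defs
begin

text \<open>By Dieudonne, a linear space of singular n by n matrices has dimension at most n(n - 1), with
  equality only for the matrices killing a fixed vector on the right or on the left. Applied to the
  combinations of a tuple, this shows that the linear subspaces of SING of the maximal dimension
  mn(n - 1) are the kernel spaces \<open>{X. \<forall>i. X\<^sub>i v = 0}\<close> and the cokernel spaces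
  \<open>{X. \<forall>i. u X\<^sub>i = 0}\<close>. A symmetry of SING permutes them, and it either preserves or exchanges the
  two types, since only distinct spaces of equal type can span everything. A type-preserving symmetry
  can be normalized to fix the coordinate spaces, hence all matrix positions, and is then seen to lie in
  the action group G; the others lie in its coset under transposition. Both cosets are cut out by
  quadrics, and G is connected because any two of its elements lie in the image of a cofinite subset of
  the complex line. All dimensions are taken over the reals, hence twice the complex ones.\<close>

section \<open>Spaces of singular matrices\<close>

text \<open>Dieudonne's theorem is obtained by perturbation. After multiplication by invertible
  matrices on both sides, a maximal singular space contains the identity with its k-th diagonal
  entry erased. Since \<open>det\<close> vanishes on every line through this matrix inside the
  space, the diagonal entry k of \<open>X\<close>, of \<open>X ** X\<close> and of
  \<open>X ** X ** X\<close> is zero for every member \<open>X\<close>. The second power lets row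
  and column k contribute only n - 1 complex dimensions besides the (n - 1)^2 of the complementary
  block, which is the origin of n(n - 1); the third power decides between row and column in the case
  of equality.

  For tuples the obstacle is that a subspace of SING need not be a product. Its coordinate
  projections are singular spaces, so the largest possible dimension forces a product, and
  combinations of the coordinates force the factors to agree.

  For n = 1 both types reduce to the zero space and transposition is the identity. This case is
  treated separately when cokernel spaces are tracked and when the two cosets are separated.\<close>

definition matrix_unit :: "'m \<Rightarrow> 'n \<Rightarrow> 'a::zero_neq_one^'n^'m"
  where "matrix_unit i j = axis i (axis j 1)"

lemma matrix_unit_nth: "matrix_unit i j $ a $ b = (if a = i \<and> b = j then 1 else 0)"
  by (simp add: matrix_unit_def axis_def)

lemma scale_matrix_mult_left:
  fixes A :: "'a::comm_semiring_1^'n^'m"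
  shows "map_matrix ((*) c) A ** B = map_matrix ((*) c) (A ** B)"
  by (simp add: vec_eq_iff matrix_matrix_mult_def sum_distrib_left mult.assoc)

lemma scale_matrix_mult_right:
  fixes A :: "'a::comm_semiring_1^'n^'m"
  shows "A ** map_matrix ((*) c) B = map_matrix ((*) c) (A ** B)"
  by (simp add: vec_eq_iff matrix_matrix_mult_def sum_distrib_left mult.left_commute)

lemma scale_matrix_vector_mult:
  fixes A :: "'a::comm_semiring_1^'n^'m"
  shows "map_matrix ((*) c) A *v x = c *s (A *v x)"
  by (simp add: vec_eq_iff matrix_vector_mult_def sum_distrib_left mult.assoc)

lemma matrix_unit_vector_mult: "matrix_unit i j *v y = axis i (y $ j :: 'a::comm_semiring_1)"
proof -
  have "(matrix_unit i j *v y) $ a = axis i (y $ j) $ a" for a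
  proof -
    have "(matrix_unit i j *v y) $ a = (\<Sum>b\<in>UNIV. if b = j then (if a = i then y $ j else 0) else 0)"
      unfolding matrix_vector_mult_def vec_lambda_beta by (rule sum.cong) (auto simp: matrix_unit_nth)
    then show ?thesis by (simp add: axis_def)
  qed
  then show ?thesis by (simp add: vec_eq_iff)
qed

lemma matrix_vector_axis: "(A *v axis k 1) $ i = (A $ i $ k :: 'a::comm_semiring_1)"
  by (simp add: matrix_vector_mult_def axis_def if_distrib sum.delta cong: if_cong)

lemma bounded_matrix_vector_mult:
  fixes A :: "complex^'n^'m"
  obtains K where "K > 0" "\<And>x. norm (A *v x) \<le> K * norm x"
  using linear_bounded_pos[OF matrix_vector_mul_linear[of A]] by blast

lemma norm_vector_scale: "norm (c *s x) = norm c * norm (x :: complex^'n)"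
  by (simp add: norm_vec_def norm_mult L2_set_right_distrib)

text \<open>A kernel vector \<open>y\<close> of the pencil satisfies
  \<open>y = y $ k *s axis k 1 - s *s (X *v y)\<close>. For \<open>s\<close> below
  \<open>1 / (2 * K)\<close> the last term has at most half the norm of \<open>y\<close>, so
  \<open>y $ k\<close> is nonzero and \<open>y\<close> can be scaled to a vector \<open>z\<close>
  with \<open>z $ k = 1\<close>, of norm at most 2. The k-th coordinate of the equation then leaves
  \<open>(X *v z) $ k = 0\<close>.\<close>

lemma singular_pencil_kernel:
  fixes X :: "complex^'n^'n"
  assumes "\<And>s. det (mat 1 - matrix_unit k k + map_matrix ((*) s) X) = 0"
  obtains d where "d > 0"
    "\<And>s::real. 0 < s \<Longrightarrow> s < d \<Longrightarrow>
      \<exists>z. norm z \<le> 2 \<and> z = axis k 1 - of_real s *s (X *v z) \<and> (X *v z) $ k = 0"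
proof -
  obtain K where K: "K > 0" "\<And>x. norm (X *v x) \<le> K * norm x"
    using bounded_matrix_vector_mult by blast
  show ?thesis
  proof (rule that[of "1 / (2 * K)"])
    show "1 / (2 * K) > 0" using K by simp
    fix s :: real assume s: "0 < s" "s < 1 / (2 * K)"
    obtain y where y: "y \<noteq> 0" "(mat 1 - matrix_unit k k + map_matrix ((*) (of_real s)) X) *v y = 0"
      using assms[of "of_real s"] invertible_det_nz invertible_left_inverse matrix_left_invertible_ker
      by metis
    have Ey: "matrix_unit k k *v y = y $ k *s axis k 1"
      by (simp add: vec_eq_iff matrix_unit_vector_mult axis_def)
    have yeq: "y = y $ k *s axis k 1 - of_real s *s (X *v y)"
      using y(2) by (simp add: matrix_vector_mult_add_rdistrib matrix_vector_mult_diff_rdistrib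
        scale_matrix_vector_mult Ey algebra_simps)
    have "norm y \<le> norm (y $ k *s (axis k 1 :: complex^'n)) + norm (of_real s *s (X *v y))"
      by (subst yeq) (rule norm_triangle_ineq4)
    also have "norm (of_real s *s (X *v y)) \<le> s * (K * norm y)"
      using s K by (simp add: norm_vector_scale)
    also have "s * (K * norm y) \<le> norm y / 2"
    proof -
      have "s * K \<le> 1/2" using s K(1) by (simp add: field_simps)
      from mult_right_mono[OF this, of "norm y"] show ?thesis by (simp add: mult.assoc)
    qed
    also have "norm (y $ k *s (axis k 1 :: complex^'n)) = norm (y $ k)"
      by (simp add: norm_vector_scale norm_axis_1)
    finally have yk: "norm y \<le> 2 * norm (y $ k)" by simp
    then have "y $ k \<noteq> 0" using y(1) by auto
    define z where "z = inverse (y $ k) *s y"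
    have zeq: "z = axis k 1 - of_real s *s (X *v z)"
    proof -
      have "z = inverse (y $ k) *s (y $ k *s axis k 1 - of_real s *s (X *v y))"
        unfolding z_def by (subst yeq) (rule refl)
      also have "\<dots> = axis k 1 - of_real s *s (X *v z)"
        using \<open>y $ k \<noteq> 0\<close> unfolding z_def vector_scalar_commute
        by (simp add: vec_eq_iff field_simps)
      finally show ?thesis .
    qed
    have "z $ k = 1" using \<open>y $ k \<noteq> 0\<close> by (simp add: z_def)
    then have "(X *v z) $ k = 0" using zeq[THEN arg_cong, of "\<lambda>v. v $ k"] s by simp
    moreover have "norm z \<le> 2"
    proof -
      have "norm z = norm y / norm (y $ k)"
        by (simp add: z_def norm_vector_scale norm_inverse divide_inverse)
      then show ?thesis using yk \<open>y $ k \<noteq> 0\<close> by (simp add: divide_le_eq)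
    qed
    ultimately show "\<exists>z. norm z \<le> 2 \<and> z = axis k 1 - of_real s *s (X *v z) \<and> (X *v z) $ k = 0"
      using zeq by blast
  qed
qed

text \<open>The kernel vectors \<open>z\<close> of the pencil tend to the k-th unit vector as \<open>s\<close> tends to 0, and
  comparing successive powers of \<open>s\<close> in \<open>(X *v z) $ k = 0\<close> kills the diagonal entry of the powers of X.\<close>

lemma singular_pencil_powers:
  fixes X :: "complex^'n^'n"
  assumes "\<And>s. det (mat 1 - matrix_unit k k + map_matrix ((*) s) X) = 0"
  shows "X $ k $ k = 0" "(X ** X) $ k $ k = 0" "(X ** X ** X) $ k $ k = 0"
proof -
  obtain d where d: "d > 0" "\<And>s::real. 0 < s \<Longrightarrow> s < d \<Longrightarrow>
      \<exists>z. norm z \<le> 2 \<and> z = axis k 1 - of_real s *s (X *v z) \<and> (X *v z) $ k = 0"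
    using singular_pencil_kernel[OF assms] by blast
  then have "\<forall>s. \<exists>z. 0 < s \<and> s < d \<longrightarrow>
      norm z \<le> 2 \<and> z = axis k 1 - of_real s *s (X *v z) \<and> (X *v z) $ k = 0" by blast
  then obtain z where z: "\<And>s::real. 0 < s \<Longrightarrow> s < d \<Longrightarrow>
      norm (z s) \<le> 2 \<and> z s = axis k 1 - of_real s *s (X *v z s) \<and> (X *v z s) $ k = 0" by metis
  \<comment> \<open>Inserting \<open>z s = axis k 1 - s *s (X *v z s)\<close> into
    \<open>(N *v z s) $ k = 0\<close> gives \<open>N $ k $ k = s * (N ** X *v z s) $ k\<close>. As
    \<open>z s\<close> stays bounded, the left side is zero; cancelling \<open>s\<close> passes the
    hypothesis on from \<open>N\<close> to \<open>N ** X\<close>, so the step can be iterated from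
    \<open>X\<close>.\<close>
  have step: "N $ k $ k = 0 \<and> (\<forall>s. 0 < s \<longrightarrow> s < d \<longrightarrow> (N ** X *v z s) $ k = 0)"
    if N: "\<forall>s. 0 < s \<longrightarrow> s < d \<longrightarrow> (N *v z s) $ k = 0" for N :: "complex^'n^'n"
  proof -
    obtain K where K: "K > 0" "\<And>x. norm ((N ** X) *v x) \<le> K * norm x"
      using bounded_matrix_vector_mult by blast
    have eq: "N $ k $ k = of_real s * (N ** X *v z s) $ k" if "0 < s" "s < d" for s
    proof -
      have "N *v z s = N *v axis k 1 - of_real s *s (N ** X *v z s)"
        by (subst z[OF that, THEN conjunct2, THEN conjunct1])
          (simp only: matrix_vector_mult_diff_distrib vector_scalar_commute matrix_vector_mul_assoc)
      then have "(N *v z s) $ k = N $ k $ k - of_real s * (N ** X *v z s) $ k"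
        by (simp add: matrix_vector_axis)
      then show ?thesis using N that by simp
    qed
    have bd: "norm (N $ k $ k) \<le> s * (2 * K)" if "0 < s" "s < d" for s
    proof -
      have "norm ((N ** X *v z s) $ k) \<le> K * norm (z s)"
        by (rule order_trans[OF Finite_Cartesian_Product.norm_nth_le K(2)])
      also have "\<dots> \<le> K * 2" using z[OF that] K by simp
      finally show ?thesis using eq[OF that] that by (simp add: norm_mult mult.commute)
    qed
    have "norm (N $ k $ k) \<le> 0"
    proof (rule field_le_epsilon)
      fix e :: real assume "e > 0"
      define s where "s = min (d/2) (e / (2 * K))"
      have s: "0 < s" "s < d" "s \<le> e / (2*K)" using \<open>e > 0\<close> d K by (auto simp: s_def)
      have "norm (N $ k $ k) \<le> s * (2 * K)" using bd s by blast
      also have "\<dots> \<le> e" using s(3) K by (simp add: field_simps)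
      finally show "norm (N $ k $ k) \<le> 0 + e" by simp
    qed
    then have "N $ k $ k = 0" by simp
    with eq show ?thesis by auto
  qed
  have 1: "\<forall>s. 0 < s \<longrightarrow> s < d \<longrightarrow> (X *v z s) $ k = 0" using z by blast
  note 2 = step[OF 1] note 3 = step[OF 2[THEN conjunct2]] note 4 = step[OF 3[THEN conjunct2]]
  show "X $ k $ k = 0" "(X ** X) $ k $ k = 0" "(X ** X ** X) $ k $ k = 0"
    using 2 3 4 by blast+
qed

section \<open>Dimension of singular spaces in normal form\<close>

definition complex_subspace :: "(complex^'n^'m) set \<Rightarrow> bool"
  where "complex_subspace M \<longleftrightarrow> subspace M \<and> (\<forall>c. \<forall>A\<in>M. map_matrix ((*) c) A \<in> M)"

definition singular_space :: "(complex^'n^'n) set \<Rightarrow> bool"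
  where "singular_space M \<longleftrightarrow> complex_subspace M \<and> (\<forall>A\<in>M. det A = 0)"

lemma dim_supported_matrices:
  fixes I :: "('m::finite \<times> 'n::finite) set"
  shows "dim {X::complex^'n^'m. \<forall>i j. (i, j) \<notin> I \<longrightarrow> X $ i $ j = 0} = 2 * card I"
proof -
  define f :: "('m \<times> 'n) \<times> complex \<Rightarrow> complex^'n^'m" where "f = (\<lambda>((i, j), b). axis i (axis j b))"
  define d where "d = f ` (I \<times> Basis)"
  have inj: "inj_on f (I \<times> Basis)"
    by (auto simp: inj_on_def f_def axis_eq_axis Basis_complex_def)
  have "d \<subseteq> Basis" by (auto simp: d_def f_def Basis_vec_def)
  then have "dim {x. \<forall>e\<in>Basis. e \<notin> d \<longrightarrow> x \<bullet> e = 0} = card d" by (rule dim_substandard)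
  also have "card d = 2 * card I"
    unfolding d_def card_image[OF inj] by (simp add: card_cartesian_product)
  also have "{x. \<forall>e\<in>Basis. e \<notin> d \<longrightarrow> x \<bullet> e = 0} = {X. \<forall>i j. (i, j) \<notin> I \<longrightarrow> X $ i $ j = 0}"
  proof -
    have mem: "axis i (axis j b) \<in> d \<longleftrightarrow> (i, j) \<in> I" if "b \<in> Basis" for i j and b :: complex
    proof
      assume "axis i (axis j b) \<in> d"
      then show "(i, j) \<in> I"
        using that by (auto simp: d_def f_def axis_eq_axis Basis_complex_def)
    next
      assume "(i, j) \<in> I"
      then have "f ((i, j), b) \<in> d" using that unfolding d_def by blast
      then show "axis i (axis j b) \<in> d" by (simp add: f_def)
    qed
    have "(\<forall>e\<in>Basis. e \<notin> d \<longrightarrow> X \<bullet> e = 0) \<longleftrightarrow> (\<forall>i j. (i, j) \<notin> I \<longrightarrow> (\<forall>b\<in>Basis. X $ i $ j \<bullet> b = 0))"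
      for X :: "complex^'n^'m"
      using mem unfolding Basis_vec_def by (auto simp: inner_axis)
    then show ?thesis by (simp add: euclidean_eq_iff[where 'a = complex])
  qed
  finally show ?thesis .
qed

text \<open>Translates the trace form into the real inner product: isotropy for the former becomes
  orthogonality to the adjoint copy, to which the dimension theory of orthogonal sums
  applies.\<close>

lemma inner_adjoint:
  fixes X :: "complex^'n^'m"
  shows "X \<bullet> (\<chi> i j. cnj (Y $ j $ i)) = Re (\<Sum>i\<in>UNIV. \<Sum>j\<in>UNIV. X $ i $ j * Y $ j $ i)"
  by (simp add: inner_vec_def inner_complex_def)

lemma matrix_add_rdistrib:
  fixes A B :: "'a::semiring_1^'n^'m"
  shows "(A + B) ** C = A ** C + B ** C"
  by (simp add: vec_eq_iff matrix_matrix_mult_def distrib_right sum.distrib)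

lemma axis_vector_matrix: "(axis k 1 v* A) $ j = (A $ k $ j :: 'a::comm_semiring_1)"
  unfolding transpose_matrix_vector[symmetric] matrix_vector_axis by (simp add: transpose_def)

lemma subspace_supported_matrices:
  "subspace {X::complex^'n^'m. \<forall>i j. (i, j) \<notin> I \<longrightarrow> X $ i $ j = 0}"
  by (auto simp: subspace_def)

text \<open>The trace form is nondegenerate on the matrices supported on row and column k off the
  diagonal, and the projection of M to them is totally isotropic.\<close>

lemma singular_space_normalized:
  fixes M :: "(complex^'n^'n) set"
  assumes M: "singular_space M" and D: "mat 1 - matrix_unit k k \<in> M"
  shows "dim M \<le> 2 * (CARD('n) * (CARD('n) - 1))" (is ?bound)
    and "dim M \<ge> 2 * (CARD('n) * (CARD('n) - 1)) \<Longrightarrow>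
      M \<subseteq> {X. X *v axis k 1 = 0} \<or> M \<subseteq> {X. axis k 1 v* X = 0}"
proof -
  let ?n = "CARD('n)"
  have sub: "subspace M" and scl: "\<And>c A. A \<in> M \<Longrightarrow> map_matrix ((*) c) A \<in> M"
    using M unfolding singular_space_def complex_subspace_def by auto
  have pencil: "det (mat 1 - matrix_unit k k + map_matrix ((*) s) X) = 0" if "X \<in> M" for X s
    using M subspace_add[OF sub D scl[OF that, of s]] unfolding singular_space_def by blast
  note pw = singular_pencil_powers[OF pencil]
  \<comment> \<open>The condition \<open>(i = k) = (j = k)\<close> holds at the position (k, k) and
    on the block off row and column k, so \<open>h\<close> keeps just the positions in
    \<open>J\<close>.\<close>
  define h :: "complex^'n^'n \<Rightarrow> complex^'n^'n"
    where "h X = (\<chi> i j. if (i = k) = (j = k) then 0 else X $ i $ j)" for X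
  define ad :: "complex^'n^'n \<Rightarrow> complex^'n^'n" where "ad X = (\<chi> i j. cnj (X $ j $ i))" for X
  define W :: "(complex^'n^'n) set"
    where "W = {X. \<forall>i j. (i, j) \<notin> (-{k}) \<times> (-{k}) \<longrightarrow> X $ i $ j = 0}"
  define J where "J = {k} \<times> (-{k}) \<union> (-{k}) \<times> {k}"
  define H :: "(complex^'n^'n) set" where "H = {X. \<forall>i j. (i, j) \<notin> J \<longrightarrow> X $ i $ j = 0}"
  have card: "card (-{k}) = ?n - 1" by (simp add: Compl_eq_Diff_UNIV card_Diff_singleton)
  have dimW: "dim W = 2 * ((?n - 1) * (?n - 1))"
    unfolding W_def dim_supported_matrices by (simp add: card card_cartesian_product)
  have "card J = 2 * (?n - 1)"
    unfolding J_def by (subst card_Un_disjoint) (auto simp: card card_cartesian_product)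
  then have dimH: "dim H = 4 * (?n - 1)"
    unfolding H_def dim_supported_matrices by simp
  have subW: "subspace W" and subH: "subspace H" unfolding W_def H_def by (rule subspace_supported_matrices)+
  have linh: "linear h" by (rule linearI) (auto simp: h_def vec_eq_iff)
  have linad: "linear ad" by (rule linearI) (auto simp: ad_def vec_eq_iff)
  have injad: "inj ad" by (auto simp: ad_def vec_eq_iff inj_def)
  define T where "T = h ` M"
  have subT: "subspace T" unfolding T_def by (rule linear_subspace_image[OF linh sub])
  \<comment> \<open>Polarization of \<open>(X ** X) $ k $ k = 0\<close>. Because the entries at (k,
    k) vanish, the polar form involves only the entries kept by \<open>h\<close> and is the trace of
    \<open>h X ** h Y\<close>.\<close>
  have orth: "h X \<bullet> ad (h Y) = 0" if X: "X \<in> M" and Y: "Y \<in> M" for X Y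
  proof -
    have "((X + Y) ** (X + Y)) $ k $ k = 0" using pw(2) subspace_add[OF sub X Y] by blast
    then have polar: "(X ** Y) $ k $ k + (Y ** X) $ k $ k = 0"
      using pw(2)[OF X] pw(2)[OF Y] by (simp add: matrix_add_ldistrib matrix_add_rdistrib add.commute)
    have "h X $ i $ j * h Y $ j $ i =
        (if i = k then X $ k $ j * Y $ j $ k else 0) + (if j = k then Y $ k $ i * X $ i $ k else 0)" for i j
      using pw(1)[OF X] pw(1)[OF Y] by (auto simp: h_def)
    then have "(\<Sum>i\<in>UNIV. \<Sum>j\<in>UNIV. h X $ i $ j * h Y $ j $ i) = (X ** Y) $ k $ k + (Y ** X) $ k $ k"
      by (simp add: sum.distrib matrix_matrix_mult_def sum.swap[of "\<lambda>i j. if i = k then _ j else _"])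
    then show ?thesis unfolding ad_def inner_adjoint polar by simp
  qed
  \<comment> \<open>\<open>T\<close> and its adjoint copy are orthogonal, have equal dimension and
    lie in \<open>H\<close>, of real dimension 4(n - 1); so \<open>T\<close> takes up at most half
    of \<open>H\<close>.\<close>
  have dimT: "dim T \<le> 2 * (?n - 1)"
  proof -
    have "dim (T \<union> ad ` T) = dim T + dim (ad ` T)"
      by (rule dim_orthogonal_sum) (auto simp: T_def orth)
    also have "dim (ad ` T) = dim T"
      by (rule eucl.dim_image_eq[OF linad]) (rule inj_on_subset[OF injad], simp)
    finally have "2 * dim T = dim (T \<union> ad ` T)" by simp
    also have "\<dots> \<le> dim H"
      by (rule dim_subset) (auto simp: T_def H_def J_def h_def ad_def)
    finally show ?thesis using dimH by simp
  qed
  have incl: "M \<subseteq> {x + y | x y. x \<in> W \<and> y \<in> T}"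
  proof
    fix X assume X: "X \<in> M"
    have "X - h X \<in> W" using pw(1)[OF X] by (auto simp: W_def h_def)
    moreover have "h X \<in> T" using X by (simp add: T_def)
    ultimately show "X \<in> {x + y | x y. x \<in> W \<and> y \<in> T}" by (auto intro: exI[of _ "X - h X"] exI[of _ "h X"])
  qed
  have "dim {x + y | x y. x \<in> W \<and> y \<in> T} \<le> dim W + dim T"
    using eucl.dim_sums_Int[OF subW subT] by simp
  also have "\<dots> \<le> 2 * ((?n - 1) * (?n - 1)) + 2 * (?n - 1)" using dimW dimT by simp
  also have "\<dots> = 2 * (?n * (?n - 1))"
    using zero_less_card_finite[where 'a = 'n] by (cases ?n) (auto simp: algebra_simps)
  finally have dimWT: "dim {x + y | x y. x \<in> W \<and> y \<in> T} \<le> 2 * (?n * (?n - 1))" .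
  show ?bound using dim_subset[OF incl] dimWT by linarith
  assume "dim M \<ge> 2 * (?n * (?n - 1))"
  then have "M = {x + y | x y. x \<in> W \<and> y \<in> T}"
    using eucl.subspace_dim_equal[OF sub subspace_sums[OF subW subT] incl] dimWT by linarith
  then have WM: "W \<subseteq> M" using subspace_0[OF subT] by force
  \<comment> \<open>Equality of dimensions puts all of \<open>W\<close> into \<open>M\<close>, so
    matrix units off row and column k may be added to \<open>X\<close>. In the entry (k, k) of the
    cube of \<open>X + ?E\<close>, a product beginning or ending with \<open>?E\<close> contributes
    nothing; besides the cube of \<open>X\<close> only \<open>X ** ?E ** X\<close> survives.\<close>
  have prod: "X $ k $ a * X $ b $ k = 0" if X: "X \<in> M" and ab: "a \<noteq> k" "b \<noteq> k" for X a b
  proof -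
    let ?E = "matrix_unit a b :: complex^'n^'n"
    have "?E \<in> W" using ab by (auto simp: W_def matrix_unit_nth)
    then have XE: "X + ?E \<in> M" using WM subspace_add[OF sub X] by blast
    have "(X + ?E) ** (X + ?E) ** (X + ?E) =
       X ** X ** X + X ** ?E ** X + (?E ** (X + ?E) ** (X + ?E) + (X ** X + X ** ?E) ** ?E)"
      by (simp add: matrix_add_ldistrib matrix_add_rdistrib algebra_simps)
    moreover have "(?E ** Y) $ k $ k = 0" "(Y ** ?E) $ k $ k = 0" for Y
      using ab by (simp_all add: matrix_matrix_mult_def matrix_unit_nth)
    ultimately have "(X ** ?E ** X) $ k $ k = 0"
      using pw(3)[OF X] pw(3)[OF XE] by (simp add: matrix_mul_assoc[symmetric])
    moreover have "(X ** ?E ** X) $ k $ k = X $ k $ a * X $ b $ k"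
    proof -
      have "(X ** ?E ** X) $ k $ k = (X *v (?E *v (X *v axis k 1))) $ k"
        by (simp add: matrix_vector_mul_assoc matrix_vector_axis matrix_mul_assoc)
      also have "\<dots> = X $ k $ a * X $ b $ k"
        by (simp add: matrix_unit_vector_mult matrix_vector_axis)
          (simp add: matrix_vector_mult_def axis_def if_distrib cong: if_cong)
      finally show ?thesis .
    qed
    ultimately show ?thesis by simp
  qed
  have ker: "X *v axis k 1 = 0 \<longleftrightarrow> (\<forall>b. X $ b $ k = 0)" for X :: "complex^'n^'n"
    by (simp add: vec_eq_iff matrix_vector_axis)
  have coker: "axis k 1 v* X = 0 \<longleftrightarrow> (\<forall>b. X $ k $ b = 0)" for X :: "complex^'n^'n"
    by (simp add: vec_eq_iff axis_vector_matrix)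
  show "M \<subseteq> {X. X *v axis k 1 = 0} \<or> M \<subseteq> {X. axis k 1 v* X = 0}"
  proof (rule ccontr)
    assume "\<not> ?thesis"
    then obtain X Y a b where X: "X \<in> M" "X $ b $ k \<noteq> 0" and Y: "Y \<in> M" "Y $ k $ a \<noteq> 0"
      unfolding subset_iff mem_Collect_eq ker coker by blast
    have ab: "a \<noteq> k" "b \<noteq> k" using X Y pw(1) by auto
    have "X $ k $ a = 0" "Y $ b $ k = 0" using prod[OF X(1) ab] prod[OF Y(1) ab] X(2) Y(2) by auto
    \<comment> \<open>The sum has a nonzero entry both in row k and in column k, against
      \<open>prod\<close>; this is the usual argument that a space is not the union of two proper
      subspaces.\<close>
    then have "(X + Y) $ k $ a * (X + Y) $ b $ k \<noteq> 0" using X Y by simp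
    then show False using prod[OF subspace_add[OF sub X(1) Y(1)] ab] by simp
  qed
qed

section \<open>Equivalence of matrices and Dieudonne's theorem\<close>

lemma det_eq_0_iff_kernel:
  fixes A :: "'a::field^'n^'n"
  shows "det A = 0 \<longleftrightarrow> (\<exists>x. x \<noteq> 0 \<and> A *v x = 0)"
  using invertible_det_nz[of A] invertible_left_inverse[of A] matrix_left_invertible_ker[of A] by metis

lemma det_eq_0_iff_cokernel:
  fixes A :: "'a::field^'n^'n"
  shows "det A = 0 \<longleftrightarrow> (\<exists>x. x \<noteq> 0 \<and> x v* A = 0)"
  using det_eq_0_iff_kernel[of "transpose A"] by (simp add: det_transpose)

lemma matrix_inv:
  fixes A :: "'a::semiring_1^'n^'n"
  assumes "invertible A"
  shows "A ** matrix_inv A = mat 1" "matrix_inv A ** A = mat 1"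
  using someI_ex[OF assms[unfolded invertible_def]] unfolding matrix_inv_def by auto

lemma scaleR_eq_map_matrix: "r *\<^sub>R X = map_matrix ((*) (of_real r)) X"
  for X :: "complex^'n^'m"
  by (simp add: vec_eq_iff scaleR_conv_of_real[where 'a = complex])

lemma complex_subspaceI:
  assumes "0 \<in> M" "\<And>A B. A \<in> M \<Longrightarrow> B \<in> M \<Longrightarrow> A + B \<in> M"
    "\<And>c A. A \<in> M \<Longrightarrow> map_matrix ((*) c) A \<in> M"
  shows "complex_subspace M"
  using assms unfolding complex_subspace_def subspace_def scaleR_eq_map_matrix by blast

lemma complex_subspace_kernel: "complex_subspace {X. X *v v = 0}"
  by (rule complex_subspaceI) (simp_all add: matrix_vector_mult_add_rdistrib scale_matrix_vector_mult)

lemma complex_subspace_cokernel: "complex_subspace {X :: complex^'n^'m. v v* X = 0}"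
proof -
  have "v v* (X + Y) = v v* X + v v* Y" "v v* map_matrix ((*) c) X = c *s (v v* X)" "v v* 0 = 0"
    for X Y :: "complex^'n^'m" and c
    by (simp_all add: vec_eq_iff vector_matrix_mult_def algebra_simps sum.distrib sum_distrib_left)
  then show ?thesis by (intro complex_subspaceI) simp_all
qed

lemma invertible_mult_eq_0:
  fixes A :: "'a::semiring_1^'n^'n"
  assumes "invertible A" "A *v x = 0"
  shows "x = 0"
proof -
  have "x = matrix_inv A *v (A *v x)"
    by (simp only: matrix_vector_mul_assoc matrix_inv[OF assms(1)] matrix_vector_mul_lid)
  then show ?thesis by (simp add: assms(2))
qed

lemma invertible_vector_mult_eq_0:
  fixes A :: "'a::comm_semiring_1^'n^'n"
  assumes "invertible A" "x v* A = 0"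
  shows "x = 0"
proof -
  have "x = (x v* A) v* matrix_inv A"
    by (simp only: vector_matrix_mul_assoc matrix_inv[OF assms(1)] vector_matrix_mul_rid)
  also have "\<dots> = 0" by (simp only: assms(2) vector_matrix_mult_0)
  finally show ?thesis .
qed

lemma singular_space_kernel: "v \<noteq> 0 \<Longrightarrow> singular_space {X. X *v v = 0}"
  unfolding singular_space_def using complex_subspace_kernel det_eq_0_iff_kernel by blast

lemma singular_space_cokernel: "v \<noteq> 0 \<Longrightarrow> singular_space {X. v v* X = 0}"
  unfolding singular_space_def using complex_subspace_cokernel det_eq_0_iff_cokernel by blast

lemma linear_matrix_mult_both:
  fixes P Q :: "complex^'n^'n"
  shows "linear (\<lambda>X. P ** X ** Q)"
  by (rule linearI) (simp_all only: matrix_add_ldistrib matrix_add_rdistrib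
      scaleR_eq_map_matrix scale_matrix_mult_left scale_matrix_mult_right)

lemma matrix_mult_both_cancel:
  fixes P Q :: "complex^'n^'n"
  assumes "invertible P" "invertible Q"
  shows "matrix_inv P ** (P ** X ** Q) ** matrix_inv Q = X"
proof -
  have "matrix_inv P ** (P ** X ** Q) ** matrix_inv Q = (matrix_inv P ** P) ** X ** (Q ** matrix_inv Q)"
    by (simp only: matrix_mul_assoc)
  also have "\<dots> = X" by (simp only: matrix_inv[OF assms(1)] matrix_inv[OF assms(2)] matrix_mul_lid matrix_mul_rid)
  finally show ?thesis .
qed

lemma inj_matrix_mult_both:
  fixes P Q :: "complex^'n^'n"
  assumes "invertible P" "invertible Q"
  shows "inj (\<lambda>X. P ** X ** Q)"
  by (rule inj_on_inverseI[where g = "\<lambda>Y. matrix_inv P ** Y ** matrix_inv Q"])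
    (rule matrix_mult_both_cancel[OF assms])

lemma singular_space_mult_both:
  fixes P Q :: "complex^'n^'n"
  assumes "singular_space M"
  shows "singular_space ((\<lambda>X. P ** X ** Q) ` M)"
proof -
  have "map_matrix ((*) c) (P ** X ** Q) = P ** map_matrix ((*) c) X ** Q" for c X
    by (simp add: scale_matrix_mult_left scale_matrix_mult_right)
  then show ?thesis
    using assms linear_subspace_image[OF linear_matrix_mult_both]
    unfolding singular_space_def complex_subspace_def by (auto simp: det_mul)
qed

text \<open>By maximality some unit matrix \<open>E\<close> completes a suitable \<open>A\<close> in N to an invertible \<open>A + c E\<close>,
  so that \<open>A\<close> has corank one and is equivalent to the identity matrix with one diagonal entry erased.\<close>

lemma maximal_singular_space_normal_form:
  fixes N :: "(complex^'n^'n) set"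
  assumes N: "singular_space N" and max: "\<And>N'. singular_space N' \<Longrightarrow> N \<subseteq> N' \<Longrightarrow> dim N' \<le> dim N"
  obtains P Q :: "complex^'n^'n" and k :: 'n where "invertible P" "invertible Q"
    "mat 1 - matrix_unit k k \<in> (\<lambda>X. P ** X ** Q) ` N"
proof -
  have sub: "subspace N" and scl: "\<And>c A. A \<in> N \<Longrightarrow> map_matrix ((*) c) A \<in> N"
    using N unfolding singular_space_def complex_subspace_def by auto
  have "mat 1 \<notin> N" using N unfolding singular_space_def by (metis det_I zero_neq_one)
  moreover have "mat 1 = (\<Sum>k\<in>UNIV. matrix_unit k k :: complex^'n^'n)"
    by (simp add: vec_eq_iff mat_def matrix_unit_nth sum.delta if_distrib cong: if_cong)
      (auto intro!: sum.neutral)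
  ultimately obtain k where k: "matrix_unit k k \<notin> N"
    using subspace_sum[OF sub, of UNIV "\<lambda>k. matrix_unit k k"] by auto
  let ?E = "matrix_unit k k :: complex^'n^'n"
  \<comment> \<open>Adjoining the line through a matrix unit outside \<open>N\<close> enlarges the
    dimension, so by maximality the new space contains an invertible matrix.\<close>
  define N' where "N' = {A + map_matrix ((*) c) ?E | A c. A \<in> N}"
  have "complex_subspace N'"
  proof (rule complex_subspaceI)
    show "0 \<in> N'" unfolding N'_def using subspace_0[OF sub]
      by (auto intro!: exI[of _ 0] simp: vec_eq_iff)
    fix X assume "X \<in> N'"
    then obtain A c where X: "A \<in> N" "X = A + map_matrix ((*) c) ?E" unfolding N'_def by auto
    have *: "map_matrix ((*) d) X = map_matrix ((*) d) A + map_matrix ((*) (d * c)) ?E" for d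
      by (simp add: X vec_eq_iff algebra_simps)
    then show "map_matrix ((*) d) X \<in> N'" for d
      unfolding N'_def using scl[OF X(1)] by blast
    fix Y assume "Y \<in> N'"
    then obtain B d where Y: "B \<in> N" "Y = B + map_matrix ((*) d) ?E" unfolding N'_def by auto
    have "X + Y = (A + B) + map_matrix ((*) (c + d)) ?E"
      by (simp add: X Y vec_eq_iff algebra_simps)
    then show "X + Y \<in> N'" unfolding N'_def using subspace_add[OF sub X(1) Y(1)] by blast
  qed
  moreover have NN': "N \<subseteq> N'"
  proof
    fix A assume "A \<in> N"
    moreover have "A = A + map_matrix ((*) 0) ?E" by (simp add: vec_eq_iff)
    ultimately show "A \<in> N'" unfolding N'_def by blast
  qed
  moreover have "\<not> singular_space N'"
  proof
    assume "singular_space N'"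
    then have "dim N' \<le> dim N" "subspace N'"
      using max NN' unfolding singular_space_def complex_subspace_def by auto
    then have "N = N'" using eucl.subspace_dim_equal[OF sub _ NN'] by blast
    moreover have "0 + map_matrix ((*) 1) ?E \<in> N'" unfolding N'_def using subspace_0[OF sub] by blast
    moreover have "0 + map_matrix ((*) 1) ?E = ?E" by (simp add: vec_eq_iff)
    ultimately show False using k by simp
  qed
  ultimately obtain A c where A: "A \<in> N" and Adet: "det (A + map_matrix ((*) c) ?E) \<noteq> 0"
    unfolding singular_space_def N'_def by blast
  define B where "B = A + map_matrix ((*) c) ?E"
  have B: "invertible B" using Adet by (simp add: invertible_det_nz B_def)
  have By: "B *v y = A *v y + axis k (c * y $ k)" for y
    by (simp add: B_def matrix_vector_mult_add_rdistrib scale_matrix_vector_mult matrix_unit_vector_mult)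
      (simp add: vec_eq_iff axis_def)
  have Binj: "x = y" if "B *v x = B *v y" for x y
    using invertible_mult_eq_0[OF B, of "x - y"] that by (simp add: matrix_vector_mult_diff_distrib)
  have "det A = 0" using N A unfolding singular_space_def by blast
  then obtain y where y: "y \<noteq> 0" "A *v y = 0" using det_eq_0_iff_kernel by blast
  have yk: "y $ k \<noteq> 0"
  proof
    assume "y $ k = 0"
    then have "B *v y = B *v 0" using By[of y] y(2) by (simp add: axis_def vec_eq_iff)
    then show False using Binj y(1) by blast
  qed
  define u where "u = inverse (y $ k) *s y"
  have u: "A *v u = 0" "u $ k = 1" using y yk by (simp_all add: u_def vector_scalar_commute)
  \<comment> \<open>\<open>P\<close> sends the k-th unit vector to the kernel vector
    \<open>u\<close> of \<open>A\<close> and fixes the other unit vectors, on which \<open>A\<close>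
    and \<open>B\<close> agree. Hence \<open>matrix_inv B ** A ** P\<close> kills the k-th unit
    vector and fixes the others.\<close>
  define P where "P = matrix (\<lambda>y. y + y $ k *s (u - axis k 1))"
  have Py: "P *v y = y + y $ k *s (u - axis k 1)" for y
    unfolding P_def by (rule matrix_works)
      (unfold_locales, simp_all add: vec_eq_iff algebra_simps)
  have "y = 0" if "P *v y = 0" for y
  proof -
    have "(P *v y) $ k = y $ k" unfolding Py by (simp add: u)
    with that have "y $ k = 0" by simp
    with that show ?thesis unfolding Py by simp
  qed
  then have P: "invertible P" using det_eq_0_iff_kernel invertible_det_nz by blast
  have "(matrix_inv B ** A ** P) *v axis j 1 = (mat 1 - ?E) *v axis j 1" for j
  proof (rule Binj)
    have "B *v ((matrix_inv B ** A ** P) *v axis j 1) = A *v (P *v axis j 1)"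
      using matrix_inv(1)[OF B] by (simp add: matrix_vector_mul_assoc matrix_mul_assoc)
    also have "\<dots> = B *v ((mat 1 - ?E) *v axis j 1)"
    proof (cases "j = k")
      case True
      have "(mat 1 - ?E) *v axis k 1 = 0"
        by (simp add: vec_eq_iff matrix_vector_axis mat_def matrix_unit_nth)
      then show ?thesis using True u by (simp add: Py)
    next
      case False
      have "(mat 1 - ?E) *v axis j 1 = axis j 1"
        using False by (simp add: matrix_vector_mult_diff_rdistrib matrix_unit_vector_mult)
          (simp add: axis_def vec_eq_iff)
      moreover have "P *v axis j 1 = axis j 1" using False by (simp add: Py) (simp add: axis_def)
      moreover have "A *v axis j 1 = B *v axis j 1"
        using False By[of "axis j 1"] by (simp add: axis_def vec_eq_iff)
      ultimately show ?thesis by simp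
    qed
    finally show "B *v ((matrix_inv B ** A ** P) *v axis j 1) = B *v ((mat 1 - ?E) *v axis j 1)" .
  qed
  then have "matrix_inv B ** A ** P = mat 1 - ?E"
    unfolding vec_eq_iff matrix_vector_axis by blast
  moreover have "invertible (matrix_inv B)"
    using matrix_inv[OF B] unfolding invertible_def by blast
  ultimately show ?thesis
    using that[of "matrix_inv B" P k] P imageI[OF A, of "\<lambda>X. matrix_inv B ** X ** P"] by simp
qed

text \<open>Enlarging \<open>M\<close> to a singular space \<open>N\<close> of the greatest
  dimension supplies the maximality behind the normal form, and both claims descend from
  \<open>N\<close> to \<open>M\<close>. Undoing the equivalence by \<open>P\<close> and
  \<open>Q\<close> turns the k-th unit vector into the common kernel vector
  \<open>Q *v axis k 1\<close> or the common cokernel vector \<open>axis k 1 v* P\<close>.\<close>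

theorem dieudonne_dim:
  fixes M :: "(complex^'n^'n) set"
  assumes M: "singular_space M"
  shows "dim M \<le> 2 * (CARD('n) * (CARD('n) - 1))"
    and "dim M \<ge> 2 * (CARD('n) * (CARD('n) - 1)) \<Longrightarrow>
      \<exists>v. v \<noteq> 0 \<and> (M \<subseteq> {X. X *v v = 0} \<or> M \<subseteq> {X. v v* X = 0})"
proof -
  have "\<forall>N. singular_space N \<and> M \<subseteq> N \<longrightarrow> dim N < Suc DIM(complex^'n^'n)"
    using dim_subset_UNIV le_imp_less_Suc by blast
  then have "\<exists>N. (singular_space N \<and> M \<subseteq> N) \<and>
      (\<forall>N'. singular_space N' \<and> M \<subseteq> N' \<longrightarrow> dim N' \<le> dim N)"
    by (rule ex_has_greatest_nat[where k = M, rotated]) (simp add: M)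
  then obtain N where N: "singular_space N" "M \<subseteq> N"
    and max: "\<And>N'. singular_space N' \<Longrightarrow> M \<subseteq> N' \<Longrightarrow> dim N' \<le> dim N" by blast
  obtain P Q :: "complex^'n^'n" and k where P: "invertible P" and Q: "invertible Q"
    and D: "mat 1 - matrix_unit k k \<in> (\<lambda>X. P ** X ** Q) ` N"
    using maximal_singular_space_normal_form[OF N(1)] max N(2) by (metis order_trans)
  note nf = singular_space_normalized[OF singular_space_mult_both[OF N(1)] D]
  have dimN: "dim ((\<lambda>X. P ** X ** Q) ` N) = dim N"
    by (rule eucl.dim_image_eq[OF linear_matrix_mult_both])
      (rule inj_on_subset[OF inj_matrix_mult_both[OF P Q]], simp)
  have MN: "dim M \<le> dim N" by (rule dim_subset[OF N(2)])
  then show "dim M \<le> 2 * (CARD('n) * (CARD('n) - 1))"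
    using nf(1) dimN by linarith
  assume "dim M \<ge> 2 * (CARD('n) * (CARD('n) - 1))"
  then consider "(\<lambda>X. P ** X ** Q) ` N \<subseteq> {X. X *v axis k 1 = 0}" | "(\<lambda>X. P ** X ** Q) ` N \<subseteq> {X. axis k 1 v* X = 0}"
    using nf(2) dimN MN by linarith
  then show "\<exists>v. v \<noteq> 0 \<and> (M \<subseteq> {X. X *v v = 0} \<or> M \<subseteq> {X. v v* X = 0})"
  proof cases
    case 1
    have "Q *v axis k 1 \<noteq> 0"
      using invertible_mult_eq_0[OF Q] by (metis axis_eq_0_iff zero_neq_one)
    moreover have "X *v (Q *v axis k 1) = 0" if "X \<in> M" for X
    proof -
      have "P *v (X *v (Q *v axis k 1)) = 0"
        using 1 that N(2) by (auto simp: matrix_vector_mul_assoc matrix_mul_assoc)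
      then show ?thesis by (rule invertible_mult_eq_0[OF P])
    qed
    ultimately show ?thesis by blast
  next
    case 2
    have "axis k 1 v* P \<noteq> 0"
      using invertible_vector_mult_eq_0[OF P] by (metis axis_eq_0_iff zero_neq_one)
    moreover have "(axis k 1 v* P) v* X = 0" if "X \<in> M" for X
    proof -
      have "((axis k 1 v* P) v* X) v* Q = 0"
        using 2 that N(2) by (auto simp: vector_matrix_mul_assoc matrix_mul_assoc)
      then show ?thesis by (rule invertible_vector_mult_eq_0[OF Q])
    qed
    ultimately show ?thesis by blast
  qed
qed

text \<open>The space of matrices killing a fixed nonzero vector is itself singular and subject to
  the dimension bound, so an inclusion of \<open>M\<close> in it is an equality.\<close>

corollary dieudonne:
  fixes M :: "(complex^'n^'n) set"
  assumes M: "singular_space M" "dim M \<ge> 2 * (CARD('n) * (CARD('n) - 1))"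
  shows "\<exists>v. v \<noteq> 0 \<and> (M = {X. X *v v = 0} \<or> M = {X. v v* X = 0})"
proof -
  have *: "M = K" if "singular_space K" "M \<subseteq> K" for K
    using eucl.subspace_dim_equal[of M K] that M dieudonne_dim(1)[OF that(1)]
    unfolding singular_space_def complex_subspace_def by linarith
  show ?thesis
    using dieudonne_dim(2)[OF M] * singular_space_kernel singular_space_cokernel by metis
qed

section \<open>Singular tuples\<close>

text \<open>Serves for three maps: the embedding of polynomials into rational functions, evaluation
  at a point, and evaluation of univariate polynomials.\<close>

lemma det_ring_hom:
  fixes \<phi> :: "'a::comm_ring_1 \<Rightarrow> 'b::comm_ring_1" and A :: "'a^'n^'n"
  assumes one: "\<phi> 1 = 1" and add: "\<And>x y. \<phi> (x + y) = \<phi> x + \<phi> y"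
    and mult: "\<And>x y. \<phi> (x * y) = \<phi> x * \<phi> y"
  shows "\<phi> (det A) = det (map_matrix \<phi> A)"
proof -
  have zero: "\<phi> 0 = 0" using add[of 0 0] by simp
  have neg: "\<phi> (- 1) = - 1" using add[of "- 1" 1] zero one by (simp add: eq_neg_iff_add_eq_0)
  have sum: "\<phi> (sum f S) = (\<Sum>x\<in>S. \<phi> (f x))" for f :: "('n \<Rightarrow> 'n) \<Rightarrow> 'a" and S
    by (induction S rule: infinite_finite_induct) (simp_all add: zero add)
  have prod: "\<phi> (prod f S) = (\<Prod>x\<in>S. \<phi> (f x))" for f :: "'n \<Rightarrow> 'a" and S
    by (induction S rule: infinite_finite_induct) (simp_all add: one mult)
  have "\<phi> (of_int (sign p)) = of_int (sign p)" for p :: "'n \<Rightarrow> 'n"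
    by (simp add: sign_def one neg)
  then show ?thesis by (simp add: det_def sum prod mult)
qed

section \<open>Evaluation of polynomials in several indeterminates\<close>

definition monomial_value :: "('m::finite \<Rightarrow> complex) \<Rightarrow> ('m \<Rightarrow>\<^sub>0 nat) \<Rightarrow> complex"
  where "monomial_value t k = (\<Prod>i\<in>UNIV. t i ^ Poly_Mapping.lookup k i)"

definition polynomial_value :: "('m::finite \<Rightarrow> complex) \<Rightarrow> (('m \<Rightarrow>\<^sub>0 nat) \<Rightarrow>\<^sub>0 complex) \<Rightarrow> complex"
  where "polynomial_value t p = (\<Sum>k\<in>Poly_Mapping.keys p. Poly_Mapping.lookup p k * monomial_value t k)"

lemma monomial_value_0: "monomial_value t 0 = 1"
  by (simp add: monomial_value_def)

lemma monomial_value_add: "monomial_value t (k + l) = monomial_value t k * monomial_value t l"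
  by (simp add: monomial_value_def lookup_add power_add prod.distrib)

lemma monomial_value_mult: "monomial_value (\<lambda>i. s i * t i) k = monomial_value s k * monomial_value t k"
  by (simp add: monomial_value_def power_mult_distrib prod.distrib)

lemma polynomial_value_superset:
  assumes "finite K" "Poly_Mapping.keys p \<subseteq> K"
  shows "polynomial_value t p = (\<Sum>k\<in>K. Poly_Mapping.lookup p k * monomial_value t k)"
  unfolding polynomial_value_def
  by (rule sum.mono_neutral_left[OF assms]) (auto simp: in_keys_iff)

lemma polynomial_value_add: "polynomial_value t (p + q) = polynomial_value t p + polynomial_value t q"
proof -
  let ?K = "Poly_Mapping.keys p \<union> Poly_Mapping.keys q"
  have K: "finite ?K" by simp
  show ?thesis
    unfolding polynomial_value_superset[OF K Un_upper1] polynomial_value_superset[OF K Un_upper2]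
      polynomial_value_superset[OF K Poly_Mapping.keys_add]
    by (simp add: lookup_add sum.distrib distrib_right)
qed

lemma polynomial_value_single: "polynomial_value t (Poly_Mapping.single k c) = c * monomial_value t k"
  by (simp add: polynomial_value_def)

lemma polynomial_value_0: "polynomial_value t 0 = 0"
  by (simp add: polynomial_value_def)

lemma polynomial_value_sum: "polynomial_value t (sum f S) = (\<Sum>x\<in>S. polynomial_value t (f x))"
  by (induction S rule: infinite_finite_induct) (simp_all add: polynomial_value_0 polynomial_value_add)

lemma polynomial_value_mult: "polynomial_value t (p * q) = polynomial_value t p * polynomial_value t q"
proof -
  have expand: "p = (\<Sum>k\<in>Poly_Mapping.keys p. Poly_Mapping.single k (Poly_Mapping.lookup p k))"
    for p :: "('a \<Rightarrow>\<^sub>0 nat) \<Rightarrow>\<^sub>0 complex"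
    by (rule poly_mapping_eqI)
      (simp add: lookup_sum lookup_single when_def sum.delta in_keys_iff)
  have "polynomial_value t (p * q) =
      polynomial_value t ((\<Sum>k\<in>Poly_Mapping.keys p. Poly_Mapping.single k (Poly_Mapping.lookup p k)) *
        (\<Sum>l\<in>Poly_Mapping.keys q. Poly_Mapping.single l (Poly_Mapping.lookup q l)))"
    by (subst expand[of p], subst expand[of q]) (rule refl)
  also have "\<dots> = polynomial_value t p * polynomial_value t q"
    by (simp add: sum_product polynomial_value_sum mult_single polynomial_value_single
        monomial_value_add mult_ac) (simp add: polynomial_value_def sum_product mult_ac)
  finally show ?thesis .
qed

lemma polynomial_value_1: "polynomial_value t 1 = 1"
  using polynomial_value_single[of t 0 1] by (simp add: monomial_value_0)

text \<open>Artin: the monomials are pairwise distinct multiplicative characters of the monoid of points,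
  hence linearly independent.\<close>

lemma monomial_values_independent:
  assumes "finite K" "\<And>t. (\<Sum>k\<in>K. c k * monomial_value t k) = 0" "k \<in> K"
  shows "c k = 0"
  using assms
proof (induction K arbitrary: c k rule: finite_induct)
  case (insert l K)
  have "c k = 0" if k: "k \<in> K" for k
  proof -
    have "k \<noteq> l" using k insert.hyps by auto
    then obtain i where i: "Poly_Mapping.lookup k i \<noteq> Poly_Mapping.lookup l i"
      using poly_mapping_eqI[of k l] by auto
    \<comment> \<open>A point with coordinate 2 where the exponents of \<open>k\<close> and
      \<open>l\<close> differ and 1 elsewhere separates the two monomials, since powers of 2 with
      distinct exponents differ.\<close>
    define s where "s = (\<lambda>j. if j = i then 2 else 1 :: complex)"
    have s: "monomial_value s k' = 2 ^ Poly_Mapping.lookup k' i" for k'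
      unfolding monomial_value_def s_def by (simp add: if_distrib[of "\<lambda>x. x ^ _"] prod.delta cong: if_cong)
    \<comment> \<open>Replacing \<open>t\<close> by its product with \<open>s\<close> in the
      relation and subtracting \<open>monomial_value s l\<close> times the relation cancels the term
      of \<open>l\<close>; the induction hypothesis applies to what is left.\<close>
    have "c k * (monomial_value s k - monomial_value s l) = 0"
    proof (rule insert.IH[where c = "\<lambda>k. c k * (monomial_value s k - monomial_value s l)", OF _ k])
      show "(\<Sum>k\<in>K. c k * (monomial_value s k - monomial_value s l) * monomial_value t k) = 0" for t
      proof -
        have "(\<Sum>k\<in>K. c k * (monomial_value s k - monomial_value s l) * monomial_value t k) =
          (\<Sum>k\<in>insert l K. c k * (monomial_value s k - monomial_value s l) * monomial_value t k)"
          using insert.hyps by simp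
        also have "\<dots> = (\<Sum>k\<in>insert l K. c k * monomial_value (\<lambda>i. s i * t i) k)
            - monomial_value s l * (\<Sum>k\<in>insert l K. c k * monomial_value t k)"
          unfolding monomial_value_mult sum_distrib_left sum_subtractf[symmetric]
          by (simp add: algebra_simps)
        also have "\<dots> = 0" using insert.prems(1) by simp
        finally show ?thesis .
      qed
    qed
    moreover have "monomial_value s k \<noteq> monomial_value s l"
    proof
      assume "monomial_value s k = monomial_value s l"
      then have "(of_nat (2 ^ Poly_Mapping.lookup k i) :: complex) = of_nat (2 ^ Poly_Mapping.lookup l i)"
        by (simp add: s)
      then have "(2::nat) ^ Poly_Mapping.lookup k i = 2 ^ Poly_Mapping.lookup l i"
        unfolding of_nat_eq_iff .
      then show False using i by simp
    qed
    ultimately show ?thesis by simp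
  qed
  moreover from this have "c l = 0"
    using insert.prems(1)[of "\<lambda>i. 1"] insert.hyps by (simp add: monomial_value_def)
  ultimately show ?case using insert.prems(2) by auto
qed simp

lemma polynomial_eq_0_iff: "p = 0 \<longleftrightarrow> (\<forall>t. polynomial_value t p = 0)"
proof
  assume "\<forall>t. polynomial_value t p = 0"
  then have "Poly_Mapping.lookup p k = 0" if "k \<in> Poly_Mapping.keys p" for k
    using monomial_values_independent[OF finite_keys _ that, of "Poly_Mapping.lookup p"]
    unfolding polynomial_value_def by blast
  then show "p = 0" by (metis in_keys_iff poly_mapping_eqI lookup_zero)
qed (simp add: polynomial_value_0)

definition combination :: "complex^'m \<Rightarrow> complex^'n^'n^'m \<Rightarrow> complex^'n^'n"
  where "combination t X = (\<chi> a b. \<Sum>i\<in>UNIV. t $ i * X $ i $ a $ b)"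

text \<open>The generic combination is the image of a matrix \<open>Q\<close> of polynomials, and
  polynomials embed injectively into rational functions, so singularity means
  \<open>det Q = 0\<close>. A polynomial vanishes iff all its values do, and evaluating
  \<open>Q\<close> at \<open>t\<close> yields the combination with coefficients
  \<open>t\<close>.\<close>

lemma SING_iff: "X \<in> SING \<longleftrightarrow> (\<forall>t. det (combination t X) = 0)"
  for X :: "complex^'n^'n^'m::{finite,linorder}"
proof -
  define Q :: "(('m \<Rightarrow>\<^sub>0 nat) \<Rightarrow>\<^sub>0 complex)^'n^'n"
    where "Q = (\<chi> a b. \<Sum>i\<in>UNIV. Poly_Mapping.single (Poly_Mapping.single i 1) (X $ i $ a $ b))"
  define \<phi> :: "(('m \<Rightarrow>\<^sub>0 nat) \<Rightarrow>\<^sub>0 complex) \<Rightarrow> 'm ratfun" where "\<phi> p = Fract p 1" for p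
  have \<phi>: "\<phi> 1 = 1" "\<phi> (p + q) = \<phi> p + \<phi> q" "\<phi> (p * q) = \<phi> p * \<phi> q" "\<phi> p = 0 \<longleftrightarrow> p = 0" for p q
    by (simp_all add: \<phi>_def One_fract_def Zero_fract_def eq_fract)
  have \<phi>sum: "\<phi> (sum f S) = (\<Sum>x\<in>S. \<phi> (f x))" for f and S :: "'m set"
    by (induction S rule: infinite_finite_induct) (simp_all add: \<phi>)
  have entry: "ratfun_var i * ratfun_const x = \<phi> (Poly_Mapping.single (Poly_Mapping.single i 1) x)" for i and x
    by (simp add: ratfun_var_def ratfun_const_def \<phi>_def mult_single)
  have "generic_combination X = map_matrix \<phi> Q"
    by (simp add: vec_eq_iff generic_combination_def Q_def \<phi>sum entry)
  then have "X \<in> SING \<longleftrightarrow> det Q = 0"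
    using det_ring_hom[of \<phi> Q] \<phi> unfolding SING_def mem_Collect_eq invertible_det_nz by metis
  also have "\<dots> \<longleftrightarrow> (\<forall>t. polynomial_value t (det Q) = 0)" by (rule polynomial_eq_0_iff)
  also have "\<dots> \<longleftrightarrow> (\<forall>t. det (combination (\<chi> i. t i) X) = 0)"
  proof -
    have "monomial_value t (Poly_Mapping.single i 1) = t i" for t and i :: 'm
      unfolding monomial_value_def
      by (simp add: lookup_single when_def if_distrib[of "\<lambda>n. _ ^ n"] prod.delta cong: if_cong)
    then have "map_matrix (polynomial_value t) Q = combination (\<chi> i. t i) X" for t
      by (simp add: vec_eq_iff Q_def combination_def polynomial_value_sum polynomial_value_single mult.commute)
    then show ?thesis
      using det_ring_hom[of "polynomial_value _" Q, OF polynomial_value_1 polynomial_value_add polynomial_value_mult]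
      by simp
  qed
  also have "\<dots> \<longleftrightarrow> (\<forall>t. det (combination t X) = 0)"
    by (metis vec_lambda_eta)
  finally show ?thesis .
qed

section \<open>Linear subspaces of the singular tuples\<close>

definition tuple_subspace :: "(complex^'n^'n^'m) set \<Rightarrow> bool"
  where "tuple_subspace L \<longleftrightarrow> subspace L \<and> (\<forall>c. \<forall>X\<in>L. tuple_scale c X \<in> L)"

definition kernel_space :: "complex^'n \<Rightarrow> (complex^'n^'n^'m) set"
  where "kernel_space v = {X. \<forall>i. X $ i *v v = 0}"

definition cokernel_space :: "complex^'n \<Rightarrow> (complex^'n^'n^'m) set"
  where "cokernel_space v = {X. \<forall>i. v v* X $ i = 0}"

definition tuple_transpose :: "complex^'n^'n^'m \<Rightarrow> complex^'n^'n^'m"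
  where "tuple_transpose X = (\<chi> i. transpose (X $ i))"

lemma tuple_scale_nth: "tuple_scale c X $ i $ a $ b = c * X $ i $ a $ b"
  by (simp add: tuple_scale_def)

lemma combination_nth: "combination t X $ a $ b = (\<Sum>i\<in>UNIV. t $ i * X $ i $ a $ b)"
  by (simp add: combination_def)

lemma linear_combination_tuple: "linear (combination t)"
  by (rule linearI) (simp_all add: vec_eq_iff combination_nth sum.distrib distrib_left scaleR_sum_right)

lemma combination_scale: "combination t (tuple_scale c X) = map_matrix ((*) c) (combination t X)"
  by (simp add: vec_eq_iff combination_nth tuple_scale_nth sum_distrib_left mult_ac)

lemma combination_axis: "combination (axis i 1) X = X $ i"
  by (simp add: vec_eq_iff combination_nth axis_def if_distrib[of "\<lambda>x. x * _"] cong: if_cong)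

lemma combination_of_axis: "combination t (axis i A) = map_matrix ((*) (t $ i)) A"
proof -
  have "t $ j * axis i A $ j $ a $ b = (if j = i then t $ i * A $ a $ b else 0)" for j a b
    by (simp add: axis_def)
  then show ?thesis by (simp add: vec_eq_iff combination_nth)
qed

lemma dim_product_le:
  fixes S :: "'m::finite \<Rightarrow> 'a::euclidean_space set"
  assumes S: "\<And>i. subspace (S i)"
  shows "dim {X :: 'a^'m. \<forall>i. X $ i \<in> S i} \<le> (\<Sum>i\<in>UNIV. dim (S i))"
proof -
  let ?D = "\<lambda>I. {X :: 'a^'m. \<forall>i. if i \<in> I then X $ i \<in> S i else X $ i = 0}"
  have sub: "subspace (?D I)" for I
    using S by (auto simp: subspace_def)
  have "dim (?D I) \<le> (\<Sum>i\<in>I. dim (S i))" for I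
  proof (induction I rule: infinite_finite_induct)
    case empty
    have "?D {} = {0}" by (auto simp: vec_eq_iff)
    then show ?case by simp
  next
    case (insert j I)
    have lin: "linear (axis j :: 'a \<Rightarrow> 'a^'m)"
      by (rule linearI) (auto simp: axis_def vec_eq_iff)
    have "?D (insert j I) \<subseteq> {x + y | x y. x \<in> axis j ` S j \<and> y \<in> ?D I}"
    proof
      fix X assume X: "X \<in> ?D (insert j I)"
      have "X = axis j (X $ j) + (\<chi> i. if i = j then 0 else X $ i)"
        by (auto simp: vec_eq_iff axis_def)
      moreover have "axis j (X $ j) \<in> axis j ` S j"
        using X by (auto dest: spec[of _ j])
      moreover have "(\<chi> i. if i = j then 0 else X $ i) \<in> ?D I"
        using X insert.hyps subspace_0[OF S] by auto
      ultimately show "X \<in> {x + y | x y. x \<in> axis j ` S j \<and> y \<in> ?D I}" by blast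
    qed
    then have "dim (?D (insert j I)) \<le> dim {x + y | x y. x \<in> axis j ` S j \<and> y \<in> ?D I}"
      by (rule dim_subset)
    also have "\<dots> \<le> dim (axis j ` S j :: ('a^'m) set) + dim (?D I)"
      using eucl.dim_sums_Int[OF linear_subspace_image[OF lin S] sub, of j I] by linarith
    also have "\<dots> \<le> dim (S j) + (\<Sum>i\<in>I. dim (S i))"
      using eucl.dim_image_le[OF lin] insert.IH by (rule add_mono)
    finally show ?case using insert.hyps by simp
  qed simp
  from this[of UNIV] show ?thesis by simp
qed

lemma singular_space_combination:
  fixes L :: "(complex^'n^'n^'m::{finite,linorder}) set"
  assumes L: "tuple_subspace L" "L \<subseteq> SING"
  shows "singular_space (combination t ` L)"
proof -
  have "subspace (combination t ` L)"
    using linear_subspace_image[OF linear_combination_tuple] L(1) unfolding tuple_subspace_def by blast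
  moreover have "map_matrix ((*) c) A \<in> combination t ` L" if "A \<in> combination t ` L" for c A
    using that L(1) unfolding tuple_subspace_def by (auto simp: combination_scale[symmetric])
  moreover have "det A = 0" if "A \<in> combination t ` L" for A
    using that L(2) SING_iff by blast
  ultimately show ?thesis unfolding singular_space_def complex_subspace_def by blast
qed

text \<open>The coordinate projections \<open>S i\<close> are singular spaces, and \<open>L\<close>
  lies in their product. The bound on each factor makes \<open>L\<close> the whole product and each
  factor as large as possible. If \<open>t $ i = 1\<close>, the image of \<open>L\<close> under
  \<open>combination t\<close> contains \<open>S i\<close>, because \<open>L\<close> contains the
  tuples concentrated at \<open>i\<close>; having no larger dimension it equals \<open>S i\<close>.
  The all-ones coefficient vector covers every \<open>i\<close> simultaneously, so all factors
  coincide.\<close>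

theorem maximal_subspaces_SING:
  fixes L :: "(complex^'n^'n^'m::{finite,linorder}) set"
  assumes L: "tuple_subspace L" "L \<subseteq> SING"
    and dimL: "dim L \<ge> CARD('m) * (2 * (CARD('n) * (CARD('n) - 1)))"
  shows "\<exists>v. v \<noteq> 0 \<and> (L = kernel_space v \<or> L = cokernel_space v)"
proof -
  let ?B = "2 * (CARD('n) * (CARD('n) - 1))"
  note sing = singular_space_combination[OF L]
  define S where "S i = combination (axis i 1) ` L" for i
  have subL: "subspace L" using L(1) unfolding tuple_subspace_def by blast
  have subS: "subspace (S i)" for i
    using sing unfolding singular_space_def complex_subspace_def S_def by blast
  have LS: "L \<subseteq> {X. \<forall>i. X $ i \<in> S i}"
    unfolding S_def combination_axis by blast
  have le: "dim (S i) \<le> ?B" for i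
    unfolding S_def by (rule dieudonne_dim(1)[OF sing])
  have prod: "dim {X. \<forall>i. X $ i \<in> S i} \<le> (\<Sum>i\<in>UNIV. dim (S i))"
    by (rule dim_product_le[OF subS])
  have total: "(\<Sum>i\<in>UNIV. dim (S i)) \<le> CARD('m) * ?B"
    using sum_bounded_above[of UNIV "\<lambda>i. dim (S i)", OF le] by simp
  have Leq: "L = {X. \<forall>i. X $ i \<in> S i}"
  proof (rule eucl.subspace_dim_equal[OF subL _ LS])
    show "subspace {X. \<forall>i. X $ i \<in> S i}" using subS by (auto simp: subspace_def)
    show "dim {X. \<forall>i. X $ i \<in> S i} \<le> dim L" using prod total dimL by linarith
  qed
  have dimS: "dim (S i) \<ge> ?B" for i
  proof (rule ccontr)
    assume "\<not> ?thesis"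
    then have "(\<Sum>i\<in>UNIV. dim (S i)) < (\<Sum>i\<in>(UNIV::'m set). ?B)"
      by (intro sum_strict_mono_ex1) (use le in \<open>auto simp: not_le\<close>)
    then have "dim L < CARD('m) * ?B" using dim_subset[OF LS] prod by simp
    then show False using dimL by linarith
  qed
  have emb: "S i \<subseteq> combination t ` L" if "t $ i = 1" for t i
  proof
    fix A assume "A \<in> S i"
    then have "axis i A \<in> L" using Leq subspace_0[OF subS] by (auto simp: axis_def)
    moreover have "combination t (axis i A) = A"
      by (simp add: combination_of_axis that vec_eq_iff)
    ultimately show "A \<in> combination t ` L" by (metis imageI)
  qed
  have full: "S i = combination t ` L" if "t $ i = 1" for t i
  proof (rule eucl.subspace_dim_equal[OF subS _ emb[OF that]])
    show "subspace (combination t ` L)"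
      using sing unfolding singular_space_def complex_subspace_def by blast
    show "dim (combination t ` L) \<le> dim (S i)"
      using dieudonne_dim(1)[OF sing] dimS order_trans by blast
  qed
  define K where "K = combination (\<chi> i. 1) ` L"
  have "S i = K" for i unfolding K_def by (rule full) simp
  then have LK: "L = {X. \<forall>i. X $ i \<in> K}" using Leq by simp
  obtain v where "v \<noteq> 0" "K = {X. X *v v = 0} \<or> K = {X. v v* X = 0}"
    using dieudonne[OF sing[of "\<chi> i. 1"]] dimS \<open>\<And>i. S i = K\<close> unfolding K_def by metis
  then show ?thesis unfolding LK kernel_space_def cokernel_space_def by blast
qed

lemma tuple_subspaceI:
  assumes "0 \<in> L" "\<And>X Y. X \<in> L \<Longrightarrow> Y \<in> L \<Longrightarrow> X + Y \<in> L"
    "\<And>c X. X \<in> L \<Longrightarrow> tuple_scale c X \<in> L"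
  shows "tuple_subspace L"
proof -
  have "r *\<^sub>R X = tuple_scale (of_real r) X" for r and X :: "complex^'n^'n^'m"
    by (simp add: vec_eq_iff tuple_scale_nth scaleR_conv_of_real[where 'a = complex])
  then show ?thesis using assms unfolding tuple_subspace_def subspace_def by metis
qed

lemma tuple_subspace_kernel_space: "tuple_subspace (kernel_space v)"
  by (rule tuple_subspaceI)
    (simp_all add: kernel_space_def tuple_scale_def matrix_vector_mult_add_rdistrib scale_matrix_vector_mult)

lemma tuple_transpose_transpose: "tuple_transpose (tuple_transpose X) = X"
  by (simp add: tuple_transpose_def)

lemma tuple_transpose_kernel_space:
  "tuple_transpose ` kernel_space v = (cokernel_space v :: (complex^'n^'n^'m) set)"
proof (intro set_eqI iffI)
  fix X :: "complex^'n^'n^'m" assume "X \<in> cokernel_space v"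
  then have "tuple_transpose X \<in> kernel_space v"
    by (simp add: kernel_space_def cokernel_space_def tuple_transpose_def)
  then show "X \<in> tuple_transpose ` kernel_space v"
    by (rule rev_image_eqI) (simp add: tuple_transpose_transpose)
qed (auto simp: kernel_space_def cokernel_space_def tuple_transpose_def)

lemma combination_mult_vector: "combination t X *v v = (\<Sum>i\<in>UNIV. t $ i *s (X $ i *v v))"
  by (simp add: vec_eq_iff combination_nth matrix_vector_mult_def sum_distrib_left sum_distrib_right
      mult.assoc sum.swap[of _ "UNIV :: 'b set"])

lemma combination_tuple_transpose: "combination t (tuple_transpose X) = transpose (combination t X)"
  by (simp add: vec_eq_iff combination_nth tuple_transpose_def transpose_def)

lemma tuple_transpose_SING: "X \<in> SING \<Longrightarrow> tuple_transpose X \<in> SING"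
  by (simp add: SING_iff combination_tuple_transpose det_transpose)

lemma kernel_space_SING: "v \<noteq> 0 \<Longrightarrow> kernel_space v \<subseteq> SING"
  unfolding SING_iff subset_iff det_eq_0_iff_kernel
  by (auto simp: kernel_space_def combination_mult_vector intro!: exI[of _ v])

text \<open>The kernel space is the real orthogonal complement of the tuples whose i-th matrix is
  the column \<open>w $ i\<close> times the adjoint of \<open>v\<close>; these form an injective
  image of a space of complex dimension mn.\<close>

lemma dim_kernel_space:
  fixes v :: "complex^'n"
  assumes "v \<noteq> 0"
  shows "dim (kernel_space v :: (complex^'n^'n^'m) set) = CARD('m) * (2 * (CARD('n) * (CARD('n) - 1)))"
proof -
  define f :: "complex^'n^'m \<Rightarrow> complex^'n^'n^'m" where "f w = (\<chi> i a b. w $ i $ a * cnj (v $ b))" for w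
  have lin: "linear f" by (rule linearI) (simp_all add: f_def vec_eq_iff algebra_simps)
  obtain b where b: "v $ b \<noteq> 0" using assms by (auto simp: vec_eq_iff)
  have inj: "inj f"
  proof (rule injI)
    fix w w' assume "f w = f w'"
    then have "f w $ i $ a $ b = f w' $ i $ a $ b" for i a by simp
    then show "w = w'" using b by (simp add: f_def vec_eq_iff)
  qed
  have fX: "f w \<bullet> X = w \<bullet> (\<chi> i. X $ i *v v)" for w X
  proof -
    have "(x * cnj y) \<bullet> z = x \<bullet> (z * y)" for x y z :: complex
      by (simp add: inner_complex_def algebra_simps)
    then show ?thesis
      by (simp add: f_def inner_vec_def matrix_vector_mult_def inner_sum_right)
  qed
  have "(\<forall>w. w \<bullet> z = 0) \<longleftrightarrow> z = 0" for z :: "complex^'n^'m"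
    by (metis inner_eq_zero_iff inner_zero_right)
  moreover have "(\<chi> i. X $ i *v v) = 0 \<longleftrightarrow> (\<forall>i. X $ i *v v = 0)" for X :: "complex^'n^'n^'m"
    by (simp add: vec_eq_iff)
  ultimately have "kernel_space v = {X \<in> UNIV. \<forall>Y\<in>range f. orthogonal Y X}"
    by (simp add: kernel_space_def orthogonal_def fX)
  moreover have "dim {X \<in> UNIV. \<forall>Y\<in>range f. orthogonal Y X} + dim (range f) = dim (UNIV :: (complex^'n^'n^'m) set)"
    by (rule dim_subspace_orthogonal_to_vectors) (simp_all add: linear_subspace_image[OF lin])
  moreover have "dim (range f) = DIM(complex^'n^'m)"
    using eucl.dim_image_eq[OF lin, of UNIV] inj by simp
  ultimately have "dim (kernel_space v :: (complex^'n^'n^'m) set) + CARD('m) * (CARD('n) * 2) = CARD('m) * (CARD('n) * (CARD('n) * 2))"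
    by simp
  moreover obtain n where "CARD('n) = Suc n" using zero_less_card_finite[where 'a = 'n] gr0_implies_Suc by blast
  ultimately show ?thesis by (simp add: algebra_simps)
qed

section \<open>The action of the product of general linear groups\<close>

text \<open>The action with \<open>R\<inverse>\<close> as its third parameter, which makes it polynomial in the parameters.\<close>

definition tensor_action ::
    "complex^'m^'m \<Rightarrow> complex^'n^'n \<Rightarrow> complex^'n^'n \<Rightarrow> complex^'n^'n^'m \<Rightarrow> complex^'n^'n^'m"
  where "tensor_action P Q T X = (\<chi> i. Q ** combination (P $ i) X ** T)"

lemma tuple_action_eq:
  fixes P :: "complex^'m^'m" and Q R :: "complex^'n^'n"
  shows "tuple_action P Q R = tensor_action P Q (matrix_inv R)"
proof
  fix X :: "complex^'n^'n^'m"
  have sum_l: "Q ** (\<Sum>j\<in>S. A j) = (\<Sum>j\<in>S. Q ** A j)" for S :: "'m set" and A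
    by (induction S rule: infinite_finite_induct) (simp_all add: matrix_add_ldistrib)
  have sum_r: "(\<Sum>j\<in>S. A j) ** T = (\<Sum>j\<in>S. A j ** T)" for S :: "'m set" and A and T :: "complex^'n^'n"
    by (induction S rule: infinite_finite_induct) (simp_all add: matrix_add_rdistrib)
  have "combination t X = (\<Sum>j\<in>UNIV. map_matrix ((*) (t $ j)) (X $ j))" for t
    by (simp add: vec_eq_iff combination_nth)
  then show "tuple_action P Q R X = tensor_action P Q (matrix_inv R) X"
    unfolding tuple_action_def tensor_action_def
    by (simp add: sum_l sum_r scale_matrix_mult_left scale_matrix_mult_right)
qed

lemma invertible_matrix_inv: "invertible A \<Longrightarrow> invertible (matrix_inv A)"
  for A :: "'a::semiring_1^'n^'n"
  unfolding invertible_def[of "matrix_inv A"] using matrix_inv by blast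

lemma matrix_inv_matrix_inv:
  fixes A :: "'a::semiring_1^'n^'n"
  assumes "invertible A"
  shows "matrix_inv (matrix_inv A) = A"
proof -
  have "matrix_inv (matrix_inv A) = A ** matrix_inv A ** matrix_inv (matrix_inv A)"
    by (simp only: matrix_inv[OF assms] matrix_mul_lid)
  also have "\<dots> = A"
    by (simp only: matrix_mul_assoc[symmetric] matrix_inv[OF invertible_matrix_inv[OF assms]] matrix_mul_rid)
  finally show ?thesis .
qed

lemma tuple_action_group_eq:
  "tuple_action_group = {tensor_action P Q T | P Q T. invertible P \<and> invertible Q \<and> invertible T}"
  unfolding tuple_action_group_def tuple_action_eq
proof (intro Collect_cong iffI; elim exE conjE)
  fix g :: "complex^'a^'a^'b \<Rightarrow> complex^'a^'a^'b" and P Q R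
  assume "g = tensor_action P Q (matrix_inv R)" "invertible P" "invertible Q" "invertible R"
  then show "\<exists>P Q T. g = tensor_action P Q T \<and> invertible P \<and> invertible Q \<and> invertible T"
    using invertible_matrix_inv by blast
next
  fix g :: "complex^'a^'a^'b \<Rightarrow> complex^'a^'a^'b" and P Q T
  assume *: "g = tensor_action P Q T" "invertible P" "invertible Q" "invertible T"
  then have "g = tensor_action P Q (matrix_inv (matrix_inv T))"
    by (simp add: matrix_inv_matrix_inv)
  then show "\<exists>P Q R. g = tensor_action P Q (matrix_inv R) \<and> invertible P \<and> invertible Q \<and> invertible R"
    using * invertible_matrix_inv by blast
qed

lemma combination_tensor_action:
  "combination t (tensor_action P Q T X) = Q ** combination (t v* P) X ** T"
proof -
  have "combination t (tensor_action P Q T X) $ a $ b = (Q ** combination (t v* P) X ** T) $ a $ b" for a b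
  proof -
    have "combination t (tensor_action P Q T X) $ a $ b =
      (\<Sum>i\<in>UNIV. t $ i * (\<Sum>s\<in>UNIV. (\<Sum>r\<in>UNIV. Q $ a $ r * (\<Sum>j\<in>UNIV. P $ i $ j * X $ j $ r $ s)) * T $ s $ b))"
      by (simp add: combination_nth tensor_action_def matrix_matrix_mult_def)
    also have "\<dots> = (\<Sum>i\<in>UNIV. \<Sum>s\<in>UNIV. \<Sum>r\<in>UNIV. \<Sum>j\<in>UNIV. Q $ a $ r * (t $ i * P $ i $ j * X $ j $ r $ s) * T $ s $ b)"
      by (simp add: sum_distrib_left sum_distrib_right mult_ac)
    also have "\<dots> = (\<Sum>s\<in>UNIV. \<Sum>r\<in>UNIV. \<Sum>j\<in>UNIV. \<Sum>i\<in>UNIV. Q $ a $ r * (t $ i * P $ i $ j * X $ j $ r $ s) * T $ s $ b)"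
      by (subst sum.swap, rule sum.cong[OF refl], subst sum.swap, rule sum.cong[OF refl], rule sum.swap)
    also have "\<dots> = (Q ** combination (t v* P) X ** T) $ a $ b"
      by (simp add: combination_nth matrix_matrix_mult_def vector_matrix_mult_def sum_distrib_left sum_distrib_right mult_ac)
    finally show ?thesis .
  qed
  then show ?thesis by (simp add: vec_eq_iff)
qed

lemma tensor_action_tensor_action:
  "tensor_action P Q T (tensor_action P' Q' T' X) = tensor_action (P ** P') (Q ** Q') (T' ** T) X"
proof -
  have "P $ i v* P' = (P ** P') $ i" for i
    by (simp add: vec_eq_iff vector_matrix_mult_def matrix_matrix_mult_def mult.commute)
  then show ?thesis
    by (simp add: tensor_action_def[of P Q T] combination_tensor_action)
      (simp add: tensor_action_def matrix_mul_assoc)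
qed

lemma tensor_action_id: "tensor_action (mat 1) (mat 1) (mat 1) X = X"
  for X :: "complex^'n^'n^'m"
proof -
  have "mat 1 $ i = (axis i 1 :: complex^'m)" for i
    by (simp add: vec_eq_iff mat_def axis_def)
  then show ?thesis by (simp add: tensor_action_def combination_axis)
qed

lemma tensor_action_add: "tensor_action P Q T (X + Y) = tensor_action P Q T X + tensor_action P Q T Y"
  by (simp add: vec_eq_iff tensor_action_def linear_add[OF linear_combination_tuple]
      matrix_add_ldistrib matrix_add_rdistrib)

lemma tensor_action_scale: "tensor_action P Q T (tuple_scale c X) = tuple_scale c (tensor_action P Q T X)"
  by (simp add: vec_eq_iff tensor_action_def combination_scale scale_matrix_mult_left scale_matrix_mult_right
      tuple_scale_nth)

lemma linear_tuple_scale_iff: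
  fixes g :: "complex^'n^'n^'m \<Rightarrow> complex^'n^'n^'m"
  shows "Vector_Spaces.linear tuple_scale tuple_scale g \<longleftrightarrow>
    (\<forall>X Y. g (X + Y) = g X + g Y) \<and> (\<forall>c X. g (tuple_scale c X) = tuple_scale c (g X))"
  by (simp add: Vector_Spaces.linear_iff vector_space_tuple_scale)

lemma tensor_action_inverse:
  assumes "invertible P" "invertible Q" "invertible T"
  shows "tensor_action P Q T (tensor_action (matrix_inv P) (matrix_inv Q) (matrix_inv T) X) = X"
    and "tensor_action (matrix_inv P) (matrix_inv Q) (matrix_inv T) (tensor_action P Q T X) = X"
  using assms by (simp_all add: tensor_action_tensor_action matrix_inv tensor_action_id)

lemma tensor_action_SING:
  fixes X :: "complex^'n^'n^'m::{finite,linorder}"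
  shows "X \<in> SING \<Longrightarrow> tensor_action P Q T X \<in> SING"
  unfolding SING_iff combination_tensor_action det_mul by simp

lemma symmetry_groupI:
  fixes g :: "complex^'n^'n^'m \<Rightarrow> complex^'n^'n^'m"
  assumes "\<And>X Y. g (X + Y) = g X + g Y" "\<And>c X. g (tuple_scale c X) = tuple_scale c (g X)"
    and "\<And>X. g (f X) = X" "\<And>X. f (g X) = X" and "\<And>X. X \<in> S \<Longrightarrow> g X \<in> S" "\<And>X. X \<in> S \<Longrightarrow> f X \<in> S"
  shows "g \<in> symmetry_group tuple_scale S"
proof -
  have "bij g" by (rule o_bij[of f]) (auto simp: assms)
  moreover have "X \<in> g ` S" if "X \<in> S" for X
    by (rule rev_image_eqI[OF assms(6)[OF that]]) (simp add: assms(3))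
  ultimately show ?thesis
    unfolding symmetry_group_def general_linear_def linear_tuple_scale_iff using assms by blast
qed

lemma tensor_action_symmetry:
  assumes "invertible P" "invertible Q" "invertible T"
  shows "tensor_action P Q T \<in> symmetry_group tuple_scale (SING :: (complex^'n^'n^'m::{finite,linorder}) set)"
  by (rule symmetry_groupI[where f = "tensor_action (matrix_inv P) (matrix_inv Q) (matrix_inv T)"])
    (simp_all add: tensor_action_add tensor_action_scale tensor_action_inverse[OF assms] tensor_action_SING)

lemma tuple_transpose_add: "tuple_transpose (X + Y) = tuple_transpose X + tuple_transpose Y"
  by (simp add: vec_eq_iff tuple_transpose_def transpose_def)

lemma tuple_transpose_scale: "tuple_transpose (tuple_scale c X) = tuple_scale c (tuple_transpose X)"
  by (simp add: vec_eq_iff tuple_transpose_def transpose_def tuple_scale_nth)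

lemma tuple_transpose_symmetry:
  "tuple_transpose \<in> symmetry_group tuple_scale (SING :: (complex^'n^'n^'m::{finite,linorder}) set)"
  by (rule symmetry_groupI[where f = tuple_transpose])
    (simp_all add: tuple_transpose_add tuple_transpose_scale tuple_transpose_transpose tuple_transpose_SING)

lemma symmetry_group_comp:
  fixes g h :: "complex^'n^'n^'m \<Rightarrow> complex^'n^'n^'m"
  assumes "g \<in> symmetry_group tuple_scale S" "h \<in> symmetry_group tuple_scale S"
  shows "g \<circ> h \<in> symmetry_group tuple_scale S"
proof -
  have "(g \<circ> h) ` S = S"
    using assms unfolding symmetry_group_def image_comp[symmetric] by simp
  then show ?thesis
    using assms unfolding symmetry_group_def general_linear_def linear_tuple_scale_iff
    by (simp add: bij_comp)
qed

lemma tensor_action_kernel_space: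
  assumes "X \<in> kernel_space v" "T *v w = v"
  shows "tensor_action P Q T X \<in> kernel_space w"
proof -
  have "combination t X *v v = 0" for t
    using assms(1) by (simp add: kernel_space_def combination_mult_vector)
  then show ?thesis
    by (simp add: kernel_space_def tensor_action_def matrix_vector_mul_assoc[symmetric] assms(2))
qed

lemma tensor_action_transpose:
  "tuple_transpose (tensor_action P Q T X) =
    tensor_action P (transpose T) (transpose Q) (tuple_transpose X)"
proof -
  have "tuple_transpose (tensor_action P Q T X) $ i =
      tensor_action P (transpose T) (transpose Q) (tuple_transpose X) $ i" for i
    unfolding tensor_action_def combination_tuple_transpose
    by (simp add: tuple_transpose_def matrix_transpose_mul matrix_mul_assoc)
  then show ?thesis by (subst vec_eq_iff) blast
qed

lemma cokernel_space_iff: "X \<in> cokernel_space v \<longleftrightarrow> tuple_transpose X \<in> kernel_space v"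
  by (simp add: cokernel_space_def kernel_space_def tuple_transpose_def)

lemma tensor_action_cokernel_space:
  assumes "X \<in> cokernel_space v" "w v* Q = v"
  shows "tensor_action P Q T X \<in> cokernel_space w"
  using tensor_action_kernel_space[of "tuple_transpose X" v "transpose Q" w] assms
  by (simp add: cokernel_space_iff tensor_action_transpose)

section \<open>Symmetries permute the maximal linear subspaces\<close>

lemma symmetry_tuple_subspace:
  fixes g :: "complex^'n^'n^'m::{finite,linorder} \<Rightarrow> complex^'n^'n^'m::{finite,linorder}"
  assumes g: "g \<in> symmetry_group tuple_scale SING"
    and L: "tuple_subspace L" "L \<subseteq> SING" "dim L \<ge> CARD('m) * (2 * (CARD('n) * (CARD('n) - 1)))"
  shows "\<exists>v. v \<noteq> 0 \<and> (g ` L = kernel_space v \<or> g ` L = cokernel_space v)"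
proof -
  have add: "g (X + Y) = g X + g Y" and scale: "g (tuple_scale c X) = tuple_scale c (g X)"
    and bij: "bij g" and S: "g ` SING = SING" for X Y c
    using g unfolding symmetry_group_def general_linear_def linear_tuple_scale_iff by auto
  have lin: "linear g"
  proof (rule linearI)
    have "r *\<^sub>R X = tuple_scale (of_real r) X" for r and X :: "(complex^'n^'n, 'm) vec"
      by (simp add: vec_eq_iff tuple_scale_nth scaleR_conv_of_real[where 'a = complex])
    then show "g (r *\<^sub>R X) = r *\<^sub>R g X" for r X by (simp add: scale)
  qed (rule add)
  show ?thesis
  proof (rule maximal_subspaces_SING)
    show "tuple_subspace (g ` L)"
      using L(1) linear_subspace_image[OF lin] scale[symmetric] unfolding tuple_subspace_def by auto
    show "g ` L \<subseteq> SING" using L(2) S by blast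
    have "dim (g ` L) = dim L"
      by (rule eucl.dim_image_eq[OF lin]) (rule inj_on_subset[OF bij_is_inj[OF bij] subset_UNIV])
    then show "dim (g ` L) \<ge> CARD('m) * (2 * (CARD('n) * (CARD('n) - 1)))" using L(3) by simp
  qed
qed

lemma symmetry_kernel_space:
  fixes g :: "complex^'n^'n^'m::{finite,linorder} \<Rightarrow> complex^'n^'n^'m::{finite,linorder}"
  assumes "g \<in> symmetry_group tuple_scale SING" "v \<noteq> 0"
  shows "\<exists>w. w \<noteq> 0 \<and> (g ` kernel_space v = kernel_space w \<or> g ` kernel_space v = cokernel_space w)"
  by (rule symmetry_tuple_subspace[OF assms(1) tuple_subspace_kernel_space kernel_space_SING[OF assms(2)]])
    (simp add: dim_kernel_space[OF assms(2)])

lemma kernel_space_scale: "c \<noteq> 0 \<Longrightarrow> kernel_space (c *s v) = kernel_space v"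
  by (simp add: kernel_space_def vector_scalar_commute)

section \<open>Sums of two maximal subspaces\<close>

lemma proportional_if_minors_0:
  fixes v w :: "complex^'n"
  assumes "v \<noteq> 0" "\<And>a b. v $ a * w $ b = v $ b * w $ a"
  obtains c where "w = c *s v"
proof -
  obtain a where a: "v $ a \<noteq> 0" using assms(1) by (auto simp: vec_eq_iff)
  have "w = (w $ a / v $ a) *s v"
    using a assms(2)[of a] by (simp add: vec_eq_iff field_simps)
  then show ?thesis by (rule that)
qed

text \<open>As \<open>v\<close> and \<open>w\<close> are not proportional, some 2 by 2 minor of
  theirs is nonzero, and with it one builds a matrix \<open>T\<close> that kills \<open>v\<close>
  and fixes \<open>w\<close>. Each \<open>X $ i\<close> splits into \<open>X $ i ** T\<close>, which
  kills \<open>v\<close>, and the remainder, which kills \<open>w\<close>.\<close>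

lemma kernel_spaces_span:
  fixes v w :: "complex^'n" and X :: "complex^'n^'n^'m"
  assumes vw: "v \<noteq> 0" "w \<noteq> 0" and ne: "kernel_space v \<noteq> (kernel_space w :: (complex^'n^'n^'m) set)"
  obtains Y Z where "X = Y + Z" "Y \<in> kernel_space v" "Z \<in> kernel_space w"
proof -
  have "\<exists>a b. v $ a * w $ b \<noteq> v $ b * w $ a"
  proof (rule ccontr)
    assume "\<nexists>a b. v $ a * w $ b \<noteq> v $ b * w $ a"
    then obtain c where c: "w = c *s v" using proportional_if_minors_0[OF vw(1), of w] by blast
    then have "c \<noteq> 0" using vw(2) by auto
    then show False using ne c kernel_space_scale by metis
  qed
  then obtain a b where ab: "v $ a * w $ b \<noteq> v $ b * w $ a" by blast
  define d where "d = v $ a * w $ b - v $ b * w $ a"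
  have d: "d \<noteq> 0" using ab by (simp add: d_def)
  define T :: "complex^'n^'n" where "T = matrix (\<lambda>x. ((v $ a * x $ b - v $ b * x $ a) / d) *s w)"
  have T: "T *v x = ((v $ a * x $ b - v $ b * x $ a) / d) *s w" for x
    unfolding T_def by (rule matrix_works)
      (unfold_locales, simp_all add: vec_eq_iff add_divide_distrib diff_divide_distrib algebra_simps)
  have "T *v v = 0" "T *v w = w" using d by (simp_all add: T, simp add: d_def)
  then have "(\<chi> i. X $ i ** T) \<in> kernel_space v" "X - (\<chi> i. X $ i ** T) \<in> kernel_space w"
    by (simp_all add: kernel_space_def matrix_vector_mul_assoc[symmetric] matrix_vector_mult_diff_rdistrib)
  then show ?thesis using that[of "\<chi> i. X $ i ** T" "X - (\<chi> i. X $ i ** T)"] by simp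
qed

text \<open>The nonzero functional that pairs \<open>w\<close> with \<open>A *v v\<close> vanishes
  when \<open>A\<close> kills \<open>v\<close> on the right or \<open>w\<close> on the left.\<close>

lemma kernel_cokernel_not_span:
  fixes v w :: "complex^'n"
  assumes "v \<noteq> 0" "w \<noteq> 0"
  obtains X :: "complex^'n^'n^'m"
    where "\<And>Y Z. Y \<in> kernel_space v \<Longrightarrow> Z \<in> cokernel_space w \<Longrightarrow> X \<noteq> Y + Z"
proof -
  obtain a b where ab: "v $ a \<noteq> 0" "w $ b \<noteq> 0" using assms by (auto simp: vec_eq_iff)
  define pair where "pair A = (\<Sum>r\<in>UNIV. w $ r * (A *v v) $ r)" for A :: "complex^'n^'n"
  have pair_eq: "pair A = (\<Sum>s\<in>UNIV. (w v* A) $ s * v $ s)" for A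
    unfolding pair_def matrix_vector_mult_def vector_matrix_mult_def
    by (simp add: sum_distrib_left sum_distrib_right mult_ac) (rule sum.swap)
  then have zero: "pair A = 0" if "A *v v = 0 \<or> w v* A = 0" for A
    using that by (elim disjE) (simp add: pair_def, simp add: pair_eq)
  have add: "pair (A + B) = pair A + pair B" for A B
    by (simp add: pair_def matrix_vector_mult_add_rdistrib distrib_left sum.distrib)
  define X :: "complex^'n^'n^'m" where "X = (\<chi> i. matrix_unit b a)"
  have X: "pair (X $ i) \<noteq> 0" for i
  proof -
    have "pair (X $ i) = (\<Sum>r\<in>UNIV. if r = b then w $ b * v $ a else 0)"
      unfolding pair_def X_def by (rule sum.cong) (auto simp: matrix_unit_vector_mult axis_def)
    then show ?thesis using ab by simp
  qed
  show ?thesis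
  proof (rule that[of X])
    fix Y Z :: "complex^'n^'n^'m" assume "Y \<in> kernel_space v" "Z \<in> cokernel_space w"
    then have "pair (Y $ i) = 0" "pair (Z $ i) = 0" for i
      using zero by (auto simp: kernel_space_def cokernel_space_def)
    then show "X \<noteq> Y + Z" using X add by force
  qed
qed

text \<open>Two distinct spaces of the same type span everything, two of different type do not.\<close>

lemma symmetry_kernel_spaces_uniform:
  fixes g :: "complex^'n^'n^'m::{finite,linorder} \<Rightarrow> complex^'n^'n^'m::{finite,linorder}"
  assumes g: "g \<in> symmetry_group tuple_scale SING"
  shows "(\<forall>v. v \<noteq> 0 \<longrightarrow> (\<exists>w. w \<noteq> 0 \<and> g ` kernel_space v = kernel_space w)) \<or>
    (\<forall>v. v \<noteq> 0 \<longrightarrow> (\<exists>w. w \<noteq> 0 \<and> g ` kernel_space v = cokernel_space w))"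
proof (rule ccontr)
  have add: "g (X + Y) = g X + g Y" and bij: "bij g" for X Y
    using g unfolding symmetry_group_def general_linear_def linear_tuple_scale_iff by auto
  assume "\<not> ?thesis"
  then obtain v v' where v: "v \<noteq> 0" "\<nexists>w. w \<noteq> 0 \<and> g ` kernel_space v = kernel_space w"
    and v': "v' \<noteq> 0" "\<nexists>w. w \<noteq> 0 \<and> g ` kernel_space v' = cokernel_space w" by blast
  obtain w where w: "w \<noteq> 0" "g ` kernel_space v = cokernel_space w"
    using symmetry_kernel_space[OF g v(1)] v(2) by blast
  obtain w' where w': "w' \<noteq> 0" "g ` kernel_space v' = kernel_space w'"
    using symmetry_kernel_space[OF g v'(1)] v'(2) by blast
  have ne: "kernel_space v' \<noteq> (kernel_space v :: (complex^'n^'n, 'm) vec set)" using v(2) w' by metis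
  obtain X :: "(complex^'n^'n, 'm) vec"
    where X: "\<And>Y Z. Y \<in> kernel_space w' \<Longrightarrow> Z \<in> cokernel_space w \<Longrightarrow> X \<noteq> Y + Z"
    using kernel_cokernel_not_span[OF w'(1) w(1)] by blast
  obtain X' where X': "X = g X'" using bij by (metis bij_pointE)
  obtain Y Z where YZ: "X' = Y + Z" "Y \<in> kernel_space v'" "Z \<in> kernel_space v"
    using kernel_spaces_span[OF v'(1) v(1) ne] by blast
  have "X = g Y + g Z" using X' YZ(1) add by simp
  moreover have "g Y \<in> kernel_space w'" "g Z \<in> cokernel_space w" using YZ w w' by blast+
  ultimately show False using X by blast
qed

text \<open>With two distinct indices available, a matrix with a single nonzero row can annihilate
  \<open>v\<close> without being annihilated by \<open>u\<close>: the row sits where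
  \<open>u\<close> is nonzero and has entries \<open>v $ b\<close> and \<open>- v $ a\<close> at
  \<open>a\<close> and \<open>b\<close>.\<close>

lemma kernel_eq_cokernel_imp_card_1:
  fixes v u :: "complex^'n"
  assumes "v \<noteq> 0" "u \<noteq> 0" and eq: "kernel_space v = (cokernel_space u :: (complex^'n^'n^'m) set)"
  shows "\<exists>a::'n. \<forall>b. b = a"
proof -
  obtain a c where a: "v $ a \<noteq> 0" and c: "u $ c \<noteq> 0" using assms by (auto simp: vec_eq_iff)
  have "b = a" for b
  proof (rule ccontr)
    assume ba: "b \<noteq> a"
    define X :: "complex^'n^'n^'m"
      where "X = (\<chi> i r s. if r = c then (if s = a then v $ b else if s = b then - v $ a else 0) else 0)"
    have "X \<in> kernel_space v"
    proof -
      have "(X $ i *v v) $ r = 0" for i r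
      proof -
        have "(X $ i *v v) $ r = (\<Sum>s\<in>UNIV. (if s = a then (if r = c then v $ b * v $ a else 0) else 0) +
          (if s = b then (if r = c then - v $ a * v $ b else 0) else 0))"
          unfolding matrix_vector_mult_def X_def using ba by (auto intro!: sum.cong)
        then show ?thesis by (simp add: sum.distrib)
      qed
      then show ?thesis by (simp add: kernel_space_def vec_eq_iff)
    qed
    moreover have "(u v* X $ i) $ b = - u $ c * v $ a" for i
    proof -
      have "(u v* X $ i) $ b = (\<Sum>r\<in>UNIV. if r = c then - u $ c * v $ a else 0)"
        unfolding vector_matrix_mult_def vec_lambda_beta X_def using ba by (intro sum.cong) auto
      then show ?thesis by simp
    qed
    ultimately show False using eq a c by (auto simp: cokernel_space_def vec_eq_iff)
  qed
  then show ?thesis by blast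
qed

lemma kernel_space_card_1:
  fixes v :: "complex^'n"
  assumes "\<forall>b. b = (a::'n)" "v \<noteq> 0"
  shows "kernel_space v = ({0} :: (complex^'n^'n^'m) set)" "cokernel_space v = ({0} :: (complex^'n^'n^'m) set)"
proof -
  have U: "UNIV = {a}" using assms(1) by auto
  have va: "v $ b \<noteq> 0" for b using assms by (metis vec_eq_iff zero_index)
  show k: "kernel_space v = ({0} :: (complex^'n^'n^'m) set)"
    using va by (auto simp: kernel_space_def vec_eq_iff matrix_vector_mult_def U) (metis assms(1))
  show "cokernel_space v = ({0} :: (complex^'n^'n^'m) set)"
    using k unfolding tuple_transpose_kernel_space[symmetric]
    by (simp add: tuple_transpose_def transpose_def vec_eq_iff)
qed

text \<open>Composing \<open>g\<close> with transposition shows that the image of a cokernel space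
  is of one of the two types. Were it of kernel type, \<open>g\<close> would carry the kernel and
  the cokernel space of \<open>u\<close>, which together do not span, to two kernel spaces, which
  span unless equal. Equality forces n = 1, where the types coincide.\<close>

lemma symmetry_cokernel_spaces:
  fixes g :: "complex^'n^'n^'m::{finite,linorder} \<Rightarrow> complex^'n^'n^'m::{finite,linorder}"
  assumes g: "g \<in> symmetry_group tuple_scale SING"
    and ker: "\<And>v. v \<noteq> 0 \<Longrightarrow> \<exists>w. w \<noteq> 0 \<and> g ` kernel_space v = kernel_space w" and u: "u \<noteq> 0"
  shows "\<exists>w. w \<noteq> 0 \<and> g ` cokernel_space u = cokernel_space w"
proof -
  have add: "g (X + Y) = g X + g Y" and bij: "bij g" for X Y
    using g unfolding symmetry_group_def general_linear_def linear_tuple_scale_iff by auto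
  obtain w where w: "w \<noteq> 0" "g ` cokernel_space u = kernel_space w \<or> g ` cokernel_space u = cokernel_space w"
    using symmetry_kernel_space[OF symmetry_group_comp[OF g tuple_transpose_symmetry] u]
    unfolding image_comp[symmetric] tuple_transpose_kernel_space by blast
  have ?thesis if wk: "g ` cokernel_space u = kernel_space w"
  proof -
    obtain w' where w': "w' \<noteq> 0" "g ` kernel_space u = kernel_space w'" using ker[OF u] by blast
    have "kernel_space w' = (kernel_space w :: (complex^'n^'n, 'm) vec set)"
    proof (rule ccontr)
      assume ne: "kernel_space w' \<noteq> (kernel_space w :: (complex^'n^'n, 'm) vec set)"
      obtain X :: "(complex^'n^'n, 'm) vec"
        where X: "\<And>Y Z. Y \<in> kernel_space u \<Longrightarrow> Z \<in> cokernel_space u \<Longrightarrow> X \<noteq> Y + Z"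
        using kernel_cokernel_not_span[OF u u] by blast
      obtain Y Z where YZ: "g X = Y + Z" "Y \<in> kernel_space w'" "Z \<in> kernel_space w"
        using kernel_spaces_span[OF w'(1) w(1) ne] by blast
      obtain Y' Z' where Y': "Y' \<in> kernel_space u" "Y = g Y'" and Z': "Z' \<in> cokernel_space u" "Z = g Z'"
        using YZ w'(2) wk by blast
      have "g X = g (Y' + Z')" using YZ(1) Y' Z' add by simp
      then have "X = Y' + Z'" using bij by (metis bij_pointE)
      then show False using X Y' Z' by blast
    qed
    then have "g ` kernel_space u = g ` cokernel_space u" using w' wk by simp
    then have "kernel_space u = (cokernel_space u :: (complex^'n^'n, 'm) vec set)"
      using bij by (simp add: bij_is_inj inj_image_eq_iff)
    then obtain a :: 'n where a: "\<forall>b. b = a" using kernel_eq_cokernel_imp_card_1[OF u u] by blast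
    show ?thesis using wk kernel_space_card_1[OF a w(1)] w(1) by metis
  qed
  then show ?thesis using w by blast
qed

section \<open>Symmetries preserving the two types of maximal subspaces\<close>

text \<open>The pure tensor of \<open>c\<close> with the unit vectors of row \<open>a\<close> and
  column \<open>b\<close>.\<close>

definition elementary :: "complex^'m \<Rightarrow> 'n \<Rightarrow> 'n \<Rightarrow> complex^'n^'n^'m"
  where "elementary c a b = (\<chi> i. map_matrix ((*) (c $ i)) (matrix_unit a b))"

lemma elementary_nth: "elementary c a b $ i $ r $ s = (if r = a \<and> s = b then c $ i else 0)"
  by (simp add: elementary_def matrix_unit_nth)

lemma elementary_mult_vector: "elementary c a b $ i *v w = axis a (c $ i * w $ b)"
  by (simp add: elementary_def scale_matrix_vector_mult matrix_unit_vector_mult) (simp add: vec_eq_iff axis_def)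

lemma elementary_add: "elementary (c + d) a b = elementary c a b + elementary d a b"
  by (simp add: vec_eq_iff elementary_nth)

lemma elementary_scale: "elementary (t *s c) a b = tuple_scale t (elementary c a b)"
  by (simp add: vec_eq_iff elementary_nth tuple_scale_nth)

lemma elementary_eq_0_iff: "elementary c a b = 0 \<longleftrightarrow> c = 0"
  by (auto simp: vec_eq_iff elementary_nth)

lemma tuple_transpose_elementary: "tuple_transpose (elementary c a b) = elementary c b a"
  by (auto simp: vec_eq_iff elementary_nth tuple_transpose_def transpose_def)

lemma kernel_space_axis: "X \<in> kernel_space (axis j 1) \<longleftrightarrow> (\<forall>i a. X $ i $ a $ j = 0)"
  by (simp add: kernel_space_def vec_eq_iff matrix_vector_axis)

lemma cokernel_space_axis: "X \<in> cokernel_space (axis j 1) \<longleftrightarrow> (\<forall>i a. X $ i $ j $ a = 0)"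
  by (simp add: cokernel_space_def vec_eq_iff axis_vector_matrix)

lemma tuple_eq_sum_elementary:
  "X = (\<Sum>a\<in>UNIV. \<Sum>b\<in>UNIV. elementary (\<chi> i. X $ i $ a $ b) a b)"
  for X :: "complex^'n^'n^'m"
proof -
  have "(\<Sum>a\<in>UNIV. \<Sum>b\<in>UNIV. elementary (\<chi> i. X $ i $ a $ b) a b) $ i $ r $ s = X $ i $ r $ s" for i r s
  proof -
    have "(\<Sum>a\<in>UNIV. \<Sum>b\<in>UNIV. elementary (\<chi> i. X $ i $ a $ b) a b) $ i $ r $ s =
        (\<Sum>a\<in>UNIV. \<Sum>b\<in>UNIV. if b = s then (if a = r then X $ i $ a $ b else 0) else 0)"
      unfolding sum_component elementary_nth by (intro sum.cong refl) auto
    then show ?thesis by simp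
  qed
  then show ?thesis by (simp add: vec_eq_iff)
qed

text \<open>A tuple supported at the position (a, b) is characterized by lying in the kernel spaces
  of all unit vectors other than the b-th and in the cokernel spaces of all other than the a-th;
  \<open>h\<close> respects each of these.\<close>

lemma axes_preserving_elementary:
  assumes "\<And>j. h ` kernel_space (axis j 1) \<subseteq> kernel_space (axis j 1)"
    and "\<And>j. h ` cokernel_space (axis j 1) \<subseteq> cokernel_space (axis j 1)"
  shows "h (elementary c a b) = elementary (\<chi> i. h (elementary c a b) $ i $ a $ b) a b"
proof -
  have "h (elementary c a b) \<in> kernel_space (axis s 1)" if "s \<noteq> b" for s
  proof -
    have "elementary c a b \<in> kernel_space (axis s 1)"
      using that by (simp add: kernel_space_axis elementary_nth)
    then show ?thesis using assms(1) by blast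
  qed
  moreover have "h (elementary c a b) \<in> cokernel_space (axis r 1)" if "r \<noteq> a" for r
  proof -
    have "elementary c a b \<in> cokernel_space (axis r 1)"
      using that by (simp add: cokernel_space_axis elementary_nth)
    then show ?thesis using assms(2) by blast
  qed
  ultimately show ?thesis
    by (auto simp: vec_eq_iff elementary_nth kernel_space_axis cokernel_space_axis)
qed

text \<open>Compares the images of two columns through the image of the kernel space of a difference of
  two unit vectors.\<close>

lemma columns_proportional:
  fixes h :: "complex^'n^'n^'m \<Rightarrow> complex^'n^'n^'m"
  assumes add: "\<And>X Y. h (X + Y) = h X + h Y" and inj: "\<And>X. h X = 0 \<Longrightarrow> X = 0"
    and elem: "\<And>c a b. h (elementary c a b) = elementary (A a b c) a b"
    and ker: "\<And>v. v \<noteq> 0 \<Longrightarrow> \<exists>w. w \<noteq> 0 \<and> h ` kernel_space v \<subseteq> kernel_space w"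
  shows "\<exists>l. (\<forall>b. l b \<noteq> 0) \<and> (\<forall>a b c. A a b c = l b *s A a k c)"
proof -
  have A0: "c = 0" if "A a b c = 0" for a b c
    using inj[of "elementary c a b"] elem[of c a b] that by (simp add: elementary_eq_0_iff)
  have "\<exists>l. l \<noteq> 0 \<and> (\<forall>a c. A a b c = l *s A a k c)" for b
  proof (cases "b = k")
    case True
    then show ?thesis by (intro exI[of _ 1]) simp
  next
    case False
    define v :: "complex^'n" where "v = axis b 1 - axis k 1"
    have vn: "v $ j = (if j = b then 1 else 0) - (if j = k then 1 else 0)" for j
      by (simp add: v_def axis_def)
    have "v $ b \<noteq> 0" using False by (simp add: vn)
    then have "v \<noteq> 0" by auto
    then obtain w where w: "w \<noteq> 0" "h ` kernel_space v \<subseteq> kernel_space w" using ker by blast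
    \<comment> \<open>Equal coefficients at (a, b) and (a, k) cancel on \<open>v\<close>, the
      difference of the two unit vectors, so the image of this sum kills \<open>w\<close>.\<close>
    have rel: "A a b c $ i * w $ b + A a k c $ i * w $ k = 0" for a c i
    proof -
      have "elementary c a b + elementary c a k \<in> kernel_space v"
        using False by (simp add: kernel_space_def matrix_vector_mult_add_rdistrib elementary_mult_vector
            vn vec_eq_iff axis_def)
      then have "elementary (A a b c) a b + elementary (A a k c) a k \<in> kernel_space w"
        using w(2) add elem by (metis image_subset_iff)
      then have "axis a (A a b c $ i * w $ b) + axis a (A a k c $ i * w $ k) = 0"
        by (simp add: kernel_space_def matrix_vector_mult_add_rdistrib elementary_mult_vector)
      from arg_cong[OF this, of "\<lambda>x. x $ a"] show ?thesis by (simp add: axis_def)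
    qed
    \<comment> \<open>A tensor at a diagonal position away from \<open>b\<close> and
      \<open>k\<close> kills \<open>v\<close>, and its image is nonzero at the same position; so
      \<open>w\<close> is supported on \<open>b\<close> and \<open>k\<close>.\<close>
    have wj: "w $ j = 0" if "j \<noteq> b" "j \<noteq> k" for j
    proof (rule ccontr)
      assume wj: "w $ j \<noteq> 0"
      have "elementary (1 :: complex^'m) j j \<in> kernel_space v"
        using that by (simp add: kernel_space_def elementary_mult_vector vn vec_eq_iff axis_def)
      then have "elementary (A j j 1) j j \<in> kernel_space w"
        using w(2) elem by (metis image_subset_iff)
      then have "\<forall>i. A j j 1 $ i * w $ j = 0"
        by (simp add: kernel_space_def elementary_mult_vector)
      then have "A j j 1 = 0" using wj by (simp add: vec_eq_iff)
      then show False using A0 by fastforce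
    qed
    have ex: "\<exists>i. A a j 1 $ i \<noteq> 0" for a j
      using A0[of a j 1] by (auto simp: vec_eq_iff)
    have wb: "w $ b \<noteq> 0"
    proof
      assume "w $ b = 0"
      then have "w $ k = 0" using rel[of k 1] ex[of k k] by auto
      then have "w = 0" using wj \<open>w $ b = 0\<close> by (metis vec_eq_iff zero_index)
      then show False using w(1) by blast
    qed
    have wk: "w $ k \<noteq> 0" using rel[of k 1] ex[of k b] wb by auto
    have "A a b c = (- w $ k / w $ b) *s A a k c" for a c
    proof -
      have "A a b c $ i = (- w $ k / w $ b) * A a k c $ i" for i
        using rel[of a c i] wb by (simp add: field_simps add_eq_0_iff)
      then show ?thesis by (simp add: vec_eq_iff)
    qed
    then show ?thesis using wb wk by (intro exI[of _ "- w $ k / w $ b"]) simp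
  qed
  then show ?thesis by metis
qed

text \<open>At each position (a, b) the map \<open>h\<close> acts on the coefficient vector by a
  linear map \<open>A a b\<close>. Proportionality along columns and along rows reduces all of them
  to one reference position: \<open>A a b\<close> is \<open>m a * l b\<close> times
  \<open>A k k\<close>. This is the action of \<open>A k k\<close> together with two diagonal
  matrices.\<close>

lemma axes_preserving_tensor_action:
  fixes h :: "complex^'n^'n^'m \<Rightarrow> complex^'n^'n^'m"
  assumes add: "\<And>X Y. h (X + Y) = h X + h Y" and scale: "\<And>c X. h (tuple_scale c X) = tuple_scale c (h X)"
    and inj: "\<And>X. h X = 0 \<Longrightarrow> X = 0"
    and axes: "\<And>j. h ` kernel_space (axis j 1) \<subseteq> kernel_space (axis j 1)"
      "\<And>j. h ` cokernel_space (axis j 1) \<subseteq> cokernel_space (axis j 1)"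
    and ker: "\<And>v. v \<noteq> 0 \<Longrightarrow> \<exists>w. w \<noteq> 0 \<and> h ` kernel_space v \<subseteq> kernel_space w"
    and coker: "\<And>v. v \<noteq> 0 \<Longrightarrow> \<exists>w. w \<noteq> 0 \<and> h ` cokernel_space v \<subseteq> cokernel_space w"
  shows "h \<in> tuple_action_group"
proof -
  define A where "A a b c = (\<chi> i. h (elementary c a b) $ i $ a $ b)" for a b c
  have elem: "h (elementary c a b) = elementary (A a b c) a b" for a b c
    unfolding A_def by (rule axes_preserving_elementary[OF axes])
  fix k :: 'n
  obtain l where l: "\<And>b. l b \<noteq> 0" "\<And>a b c. A a b c = l b *s A a k c"
    using columns_proportional[OF add inj elem ker, of k] by blast
  \<comment> \<open>Rows are compared by applying the result on columns to the conjugate of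
    \<open>h\<close> by transposition, which exchanges the hypotheses on kernel and cokernel
    spaces.\<close>
  have "\<exists>l. (\<forall>b. l b \<noteq> 0) \<and> (\<forall>a b c. A b a c = l b *s A k a c)"
  proof (rule columns_proportional)
    let ?h = "\<lambda>X. tuple_transpose (h (tuple_transpose X))"
    show "?h (X + Y) = ?h X + ?h Y" for X Y by (simp add: tuple_transpose_add add)
    show "X = 0" if "?h X = 0" for X
    proof -
      have t0: "tuple_transpose 0 = (0 :: complex^'n^'n^'m)"
        by (simp add: vec_eq_iff tuple_transpose_def transpose_def)
      then have "h (tuple_transpose X) = 0"
        using that tuple_transpose_transpose by metis
      then have "tuple_transpose X = 0" by (rule inj)
      then show ?thesis using t0 tuple_transpose_transpose by metis
    qed
    show "?h (elementary c a b) = elementary (A b a c) a b" for a b c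
      by (simp add: tuple_transpose_elementary elem)
    show "\<exists>w. w \<noteq> 0 \<and> ?h ` kernel_space v \<subseteq> kernel_space w" if v: "v \<noteq> 0" for v
    proof -
      obtain w where w: "w \<noteq> 0" "h ` cokernel_space v \<subseteq> cokernel_space w" using coker[OF v] by blast
      have "?h X \<in> kernel_space w" if X: "X \<in> kernel_space v" for X
      proof -
        have "tuple_transpose X \<in> cokernel_space v"
          using X by (simp only: cokernel_space_iff tuple_transpose_transpose)
        then have "h (tuple_transpose X) \<in> cokernel_space w" using w(2) by blast
        then show ?thesis by (simp only: cokernel_space_iff)
      qed
      then show ?thesis using w(1) by blast
    qed
  qed
  then obtain m where m: "\<And>a. m a \<noteq> 0" "\<And>a b c. A a b c = m a *s A k b c" by blast
  define P where "P = matrix (A k k)"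
  have P: "P *v c = A k k c" for c
    unfolding P_def
  proof (rule matrix_works)
    have "A k k (c + d) = A k k c + A k k d" "A k k (t *s c) = t *s A k k c" for c d t
      by (simp_all add: A_def elementary_add elementary_scale add scale vec_eq_iff tuple_scale_nth)
    then show "Vector_Spaces.linear (*s) (*s) (A k k)"
      by (simp add: Vector_Spaces.linear_iff vec.vector_space_axioms)
  qed
  have "c = 0" if "P *v c = 0" for c
    using inj[of "elementary c k k"] that by (simp add: P elem elementary_eq_0_iff)
  then have Pinv: "invertible P" using det_eq_0_iff_kernel invertible_det_nz by blast
  define D where "D f = (\<chi> r s. if r = s then f r else 0)" for f :: "'n \<Rightarrow> complex"
  have Dinv: "invertible (D f)" if "\<And>a. f a \<noteq> 0" for f
  proof -
    have "D f *v x = (\<chi> r. f r * x $ r)" for x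
      by (simp add: D_def matrix_vector_mult_def vec_eq_iff if_distrib[of "\<lambda>y. y * _"] cong: if_cong)
    then have "x = 0" if "D f *v x = 0" for x
      using that \<open>\<And>a. f a \<noteq> 0\<close> by (simp add: vec_eq_iff)
    then show ?thesis using det_eq_0_iff_kernel invertible_det_nz by blast
  qed
  have "h X = tensor_action P (D m) (D l) X" for X
  proof -
    have h_sum: "h (sum f S) = (\<Sum>x\<in>S. h (f x))" for f :: "'n \<Rightarrow> complex^'n^'n^'m" and S
    proof (induction S rule: infinite_finite_induct)
      show "h (sum f {}) = (\<Sum>x\<in>{}. h (f x))" using add[of 0 0] by simp
    qed (use add[of 0 0] add in simp_all)
    have "h X $ i $ r $ s = tensor_action P (D m) (D l) X $ i $ r $ s" for i r s
    proof -
      let ?x = "\<lambda>a b. \<chi> i. X $ i $ a $ b"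
      have "h X = h (\<Sum>a\<in>UNIV. \<Sum>b\<in>UNIV. elementary (?x a b) a b)"
        using tuple_eq_sum_elementary[of X] by simp
      also have "\<dots> = (\<Sum>a\<in>UNIV. \<Sum>b\<in>UNIV. elementary (A a b (?x a b)) a b)"
        by (simp add: h_sum elem)
      also have "\<dots> $ i $ r $ s = A r s (?x r s) $ i"
      proof -
        have "(\<Sum>a\<in>UNIV. \<Sum>b\<in>UNIV. elementary (A a b (?x a b)) a b) $ i $ r $ s =
          (\<Sum>a\<in>UNIV. \<Sum>b\<in>UNIV. if b = s then (if a = r then A a b (?x a b) $ i else 0) else 0)"
          unfolding sum_component elementary_nth by (intro sum.cong refl) auto
        then show ?thesis by simp
      qed
      also have "\<dots> = l s * (m r * (P *v ?x r s) $ i)"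
        using l(2)[of r s "?x r s"] m(2)[of r k "?x r s"] by (simp add: P)
      also have "\<dots> = tensor_action P (D m) (D l) X $ i $ r $ s"
        by (simp add: tensor_action_def D_def matrix_matrix_mult_def combination_nth matrix_vector_mult_def
            if_distrib[of "\<lambda>y. y * _"] if_distrib[of "\<lambda>y. _ * y"] cong: if_cong)
      finally show ?thesis .
    qed
    then show ?thesis by (simp add: vec_eq_iff)
  qed
  then have "h = tensor_action P (D m) (D l)" by blast
  moreover have "invertible (D m)" "invertible (D l)" by (simp_all add: Dinv m(1) l(1))
  ultimately show ?thesis unfolding tuple_action_group_eq using Pinv by blast
qed

text \<open>If a nonzero \<open>y\<close> annihilates \<open>W\<close> from the left, the tuple of
  matrices with every row equal to \<open>y\<close> kills all columns of \<open>W\<close>.\<close>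

lemma invertible_if_kernel_spaces_disjoint:
  fixes W :: "complex^'n^'n"
  assumes "\<And>X :: complex^'n^'n^'m. (\<And>j. X \<in> kernel_space (W *v axis j 1)) \<Longrightarrow> X = 0"
  shows "invertible W"
proof (rule ccontr)
  assume "\<not> ?thesis"
  then obtain y where y: "y \<noteq> 0" "y v* W = 0"
    using det_eq_0_iff_cokernel invertible_det_nz by blast
  define X :: "complex^'n^'n^'m" where "X = (\<chi> i a. y)"
  have "X \<in> kernel_space (W *v axis j 1)" for j
  proof -
    have "(X $ i *v (W *v axis j 1)) $ a = (y v* W) $ j" for i a
      by (simp add: X_def matrix_vector_mult_def[of "\<chi> a. y"] matrix_vector_axis)
        (simp add: vector_matrix_mult_def mult.commute)
    then show ?thesis by (simp add: kernel_space_def vec_eq_iff y(2))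
  qed
  then have "X = 0" by (rule assms)
  then have "X $ undefined $ undefined = 0" by simp
  then show False using y(1) by (simp add: X_def)
qed

text \<open>The columns of \<open>W\<close> and the rows of \<open>U\<close> are the vectors whose
  kernel and cokernel spaces are the images of the coordinate ones. Since the coordinate spaces of
  either type meet in zero and \<open>g\<close> is injective, \<open>W\<close> and \<open>U\<close>
  are invertible. Following \<open>g\<close> by the action of \<open>U\<close> and \<open>W\<close>
  brings every coordinate space back into itself.\<close>

lemma type_preserving_symmetry:
  fixes g :: "complex^'n^'n^'m::{finite,linorder} \<Rightarrow> complex^'n^'n^'m::{finite,linorder}"
  assumes g: "g \<in> symmetry_group tuple_scale SING"
    and ker: "\<And>v. v \<noteq> 0 \<Longrightarrow> \<exists>w. w \<noteq> 0 \<and> g ` kernel_space v = kernel_space w"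
  shows "g \<in> tuple_action_group"
proof -
  have add: "g (X + Y) = g X + g Y" and scale: "g (tuple_scale c X) = tuple_scale c (g X)"
    and bij: "bij g" for X Y c
    using g unfolding symmetry_group_def general_linear_def linear_tuple_scale_iff by auto
  have g0: "g 0 = 0" using add[of 0 0] by simp
  note coker = symmetry_cokernel_spaces[OF g ker]
  have "\<forall>j. \<exists>w. g ` kernel_space (axis j 1) = kernel_space w"
    using ker by (metis axis_eq_0_iff zero_neq_one)
  then obtain w where w: "\<And>j. g ` kernel_space (axis j 1) = kernel_space (w j)" by metis
  have "\<forall>j. \<exists>w. g ` cokernel_space (axis j 1) = cokernel_space w"
    using coker by (metis axis_eq_0_iff zero_neq_one)
  then obtain u where u: "\<And>j. g ` cokernel_space (axis j 1) = cokernel_space (u j)" by metis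
  define W where "W = (\<chi> a j. w j $ a)"
  define U where "U = (\<chi> i. u i)"
  have We: "W *v axis j 1 = w j" for j
    by (simp add: vec_eq_iff matrix_vector_axis W_def)
  have eU: "axis j 1 v* U = u j" for j
    by (simp add: vec_eq_iff axis_vector_matrix U_def)
  have zero_if: "X = 0" if "\<And>j. X \<in> g ` L j" "\<And>Y. (\<And>j. Y \<in> L j) \<Longrightarrow> Y = 0" for X and L :: "'n \<Rightarrow> _ set"
  proof -
    obtain Y where Y: "X = g Y" using bij by (metis bij_pointE)
    have YL: "Y \<in> L j" for j
      using that(1)[of j] bij unfolding Y by (simp add: bij_is_inj inj_image_mem_iff)
    have "Y = 0" by (rule that(2)) (rule YL)
    then show ?thesis using Y g0 by simp
  qed
  have W: "invertible W"
  proof (rule invertible_if_kernel_spaces_disjoint)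
    fix X :: "(complex^'n^'n, 'm) vec" assume "\<And>j. X \<in> kernel_space (W *v axis j 1)"
    then show "X = 0"
      unfolding We w[symmetric] by (rule zero_if[where L = "\<lambda>j. kernel_space (axis j 1)"])
        (simp add: kernel_space_axis vec_eq_iff)
  qed
  have "invertible (transpose U)"
  proof (rule invertible_if_kernel_spaces_disjoint)
    fix X :: "(complex^'n^'n, 'm) vec" assume "\<And>j. X \<in> kernel_space (transpose U *v axis j 1)"
    then have "tuple_transpose X \<in> g ` cokernel_space (axis j 1)" for j
      unfolding u cokernel_space_iff tuple_transpose_transpose by (simp add: eU)
    then have "tuple_transpose X = 0"
      by (rule zero_if[where L = "\<lambda>j. cokernel_space (axis j 1)"])
        (simp add: cokernel_space_axis vec_eq_iff)
    then show "X = 0" by (simp add: vec_eq_iff tuple_transpose_def transpose_def)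
  qed
  then have U: "invertible U" by (simp add: invertible_det_nz det_transpose)
  define h where "h = tensor_action (mat 1) U W \<circ> g"
  have I: "invertible (mat 1 :: ((complex, 'm) vec, 'm) vec)" by (simp add: invertible_det_nz)
  note inverse = tensor_action_inverse[OF I U W]
  have "h \<in> tuple_action_group"
  proof (rule axes_preserving_tensor_action)
    show "h (X + Y) = h X + h Y" "h (tuple_scale c X) = tuple_scale c (h X)" for X Y c
      by (simp_all add: h_def add scale tensor_action_add tensor_action_scale)
    show "X = 0" if "h X = 0" for X
    proof -
      have "tensor_action (mat 1) U W 0 = (0 :: (complex^'n^'n, 'm) vec)"
        using tensor_action_add[of "mat 1" U W 0 0] by simp
      then have "g X = 0" using that inverse(2) unfolding h_def comp_def by metis
      then show ?thesis using g0 bij by (metis bij_pointE)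
    qed
    show "h ` kernel_space (axis j 1) \<subseteq> kernel_space (axis j 1)" for j
      unfolding h_def image_comp[symmetric] w using tensor_action_kernel_space[OF _ We] by blast
    show "h ` cokernel_space (axis j 1) \<subseteq> cokernel_space (axis j 1)" for j
      unfolding h_def image_comp[symmetric] u using tensor_action_cokernel_space[OF _ eU] by blast
    show "\<exists>w. w \<noteq> 0 \<and> h ` kernel_space v \<subseteq> kernel_space w" if v: "v \<noteq> 0" for v
    proof -
      obtain y where y: "y \<noteq> 0" "g ` kernel_space v = kernel_space y" using ker[OF v] by blast
      have Wy: "W *v (matrix_inv W *v y) = y"
        by (simp only: matrix_vector_mul_assoc matrix_inv[OF W] matrix_vector_mul_lid)
      have "h ` kernel_space v \<subseteq> kernel_space (matrix_inv W *v y)"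
        unfolding h_def image_comp[symmetric] y using tensor_action_kernel_space[OF _ Wy] by blast
      moreover have "matrix_inv W *v y \<noteq> 0" using Wy y(1) by auto
      ultimately show ?thesis by blast
    qed
    show "\<exists>w. w \<noteq> 0 \<and> h ` cokernel_space v \<subseteq> cokernel_space w" if v: "v \<noteq> 0" for v
    proof -
      obtain y where y: "y \<noteq> 0" "g ` cokernel_space v = cokernel_space y" using coker[OF _ v] by blast
      have yU: "(y v* matrix_inv U) v* U = y"
        by (simp only: vector_matrix_mul_assoc matrix_inv[OF U] vector_matrix_mul_rid)
      have "h ` cokernel_space v \<subseteq> cokernel_space (y v* matrix_inv U)"
        unfolding h_def image_comp[symmetric] y using tensor_action_cokernel_space[OF _ yU] by blast
      moreover have "y v* matrix_inv U \<noteq> 0" using yU y(1) by auto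
      ultimately show ?thesis by blast
    qed
  qed
  then obtain P Q T where h: "h = tensor_action P Q T" and inv: "invertible P" "invertible Q" "invertible T"
    unfolding tuple_action_group_eq by blast
  let ?g = "tensor_action (matrix_inv (mat 1) ** P) (matrix_inv U ** Q) (T ** matrix_inv W)"
  have hX: "tensor_action (mat 1) U W (g X) = tensor_action P Q T X" for X
    using fun_cong[OF h, of X] by (simp only: h_def comp_def)
  have "?g X = g X" for X
    using inverse(2)[of "g X"] by (simp only: hX tensor_action_tensor_action)
  then have "g = ?g" by (intro ext) (rule sym)
  moreover have "invertible (matrix_inv (mat 1) ** P)" "invertible (matrix_inv U ** Q)" "invertible (T ** matrix_inv W)"
    by (intro invertible_mult invertible_matrix_inv inv I U W)+
  ultimately show ?thesis unfolding tuple_action_group_eq by blast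
qed

theorem symmetry_group_SING:
  fixes g :: "complex^'n^'n^'m::{finite,linorder} \<Rightarrow> complex^'n^'n^'m::{finite,linorder}"
  assumes g: "g \<in> symmetry_group tuple_scale SING"
  shows "g \<in> tuple_action_group \<or> tuple_transpose \<circ> g \<in> tuple_action_group"
  using symmetry_kernel_spaces_uniform[OF g]
proof
  assume "\<forall>v. v \<noteq> 0 \<longrightarrow> (\<exists>w. w \<noteq> 0 \<and> g ` kernel_space v = kernel_space w)"
  then show ?thesis using type_preserving_symmetry[OF g] by blast
next
  assume *: "\<forall>v. v \<noteq> 0 \<longrightarrow> (\<exists>w. w \<noteq> 0 \<and> g ` kernel_space v = cokernel_space w)"
  have tc: "tuple_transpose ` cokernel_space w = (kernel_space w :: (complex^'n^'n, 'm) vec set)" for w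
    unfolding tuple_transpose_kernel_space[symmetric] by (simp add: image_image tuple_transpose_transpose)
  have "tuple_transpose \<circ> g \<in> tuple_action_group"
  proof (rule type_preserving_symmetry)
    show "tuple_transpose \<circ> g \<in> symmetry_group tuple_scale SING"
      by (rule symmetry_group_comp[OF tuple_transpose_symmetry g])
    show "\<exists>w. w \<noteq> 0 \<and> (tuple_transpose \<circ> g) ` kernel_space v = kernel_space w" if "v \<noteq> 0" for v
      using * that tc unfolding image_comp[symmetric] by metis
  qed
  then show ?thesis ..
qed

section \<open>The action group is connected\<close>

text \<open>The parameter is complex: deleting finitely many points leaves the complex plane
  connected, whereas it may disconnect a real segment.\<close>

definition segment_to_identity :: "complex \<Rightarrow> complex^'n^'n \<Rightarrow> complex^'n^'n"
  where "segment_to_identity z P = (\<chi> i j. (1 - z) * mat 1 $ i $ j + z * P $ i $ j)"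

lemma segment_to_identity_0: "segment_to_identity 0 P = mat 1"
  and segment_to_identity_1: "segment_to_identity 1 P = P"
  by (simp_all add: segment_to_identity_def vec_eq_iff)

text \<open>The determinant along the line is a polynomial in \<open>z\<close> with value 1 at 0, so
  it has finitely many roots.\<close>

lemma finite_singular_segment: "finite {z. \<not> invertible (segment_to_identity z P)}"
proof -
  define M where "M = (\<chi> i j. [:mat 1 $ i $ j, P $ i $ j - mat 1 $ i $ j:])"
  have "poly (det M) z = det (map_matrix (\<lambda>p. poly p z) M)" for z
    by (rule det_ring_hom) simp_all
  also have "map_matrix (\<lambda>p. poly p z) M = segment_to_identity z P" for z
    by (simp add: vec_eq_iff M_def segment_to_identity_def algebra_simps)
  finally have M: "poly (det M) z = det (segment_to_identity z P)" for z .
  have "det M \<noteq> 0" using M[of 0] by (auto simp: segment_to_identity_0)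
  then show ?thesis using poly_roots_finite[of "det M"] by (simp add: M invertible_det_nz)
qed

text \<open>Makes Zariski closed conditions Euclidean closed along a curve of endomorphisms; for
  matrix coefficients this is the continuity of linear functionals in finite dimension.\<close>

lemma continuous_on_polynomial_function:
  fixes \<gamma> :: "complex \<Rightarrow> complex^'n^'n^'m \<Rightarrow> complex^'n^'n^'m"
  assumes "f \<in> polynomial_functions_End tuple_scale" and \<gamma>: "\<And>X. continuous_on S (\<lambda>z. \<gamma> z X)"
  shows "continuous_on S (\<lambda>z. f (\<gamma> z))"
  using assms(1)
proof (induction rule: polynomial_functions_End.induct)
  case (coeff \<phi> X)
  have "r *\<^sub>R X = tuple_scale (of_real r) X" for r and X :: "complex^'n^'n^'m"
    by (simp add: vec_eq_iff tuple_scale_nth scaleR_conv_of_real[where 'a = complex])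
  then have "linear \<phi>"
    using coeff by (intro linearI) (simp_all add: Vector_Spaces.linear_iff scaleR_conv_of_real)
  then have "continuous_on UNIV \<phi>"
    by (simp add: linear_continuous_on linear_conv_bounded_linear)
  then show ?case by (rule continuous_on_compose2[OF _ \<gamma>]) simp
qed (auto intro!: continuous_intros)

lemma continuous_on_tensor_segment:
  "continuous_on S (\<lambda>z. tensor_action (segment_to_identity z P) (segment_to_identity z Q) (segment_to_identity z T) X)"
  unfolding tensor_action_def combination_def matrix_matrix_mult_def segment_to_identity_def vec_lambda_beta
  by (intro continuous_intros)

lemma symmetry_group_topspace:
  "topspace (subtopology (zariski_GL scl) (symmetry_group scl S)) = symmetry_group scl S"
  by (auto simp: topspace_zariski_GL symmetry_group_def)

text \<open>The curve through the identity at 0 and \<open>g\<close> at 1 is continuous from the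
  Euclidean topology on the cofinite set \<open>D\<close> to the Zariski topology, so the image of
  \<open>D\<close> is a connected set of symmetries that contains both.\<close>

lemma tuple_action_group_connected:
  fixes g :: "complex^'n^'n^'m::{finite,linorder} \<Rightarrow> complex^'n^'n^'m::{finite,linorder}"
  assumes "g \<in> tuple_action_group"
  shows "g \<in> connected_symmetry_group tuple_scale SING"
proof -
  obtain P Q T where g: "g = tensor_action P Q T" and inv: "invertible P" "invertible Q" "invertible T"
    using assms unfolding tuple_action_group_eq by blast
  define D where "D = UNIV - ({z. \<not> invertible (segment_to_identity z P)} \<union>
    {z. \<not> invertible (segment_to_identity z Q)} \<union> {z. \<not> invertible (segment_to_identity z T)})"
  define \<gamma> :: "complex \<Rightarrow> (complex^'n^'n, 'm) vec \<Rightarrow> (complex^'n^'n, 'm) vec"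
    where "\<gamma> z = tensor_action (segment_to_identity z P) (segment_to_identity z Q) (segment_to_identity z T)" for z
  let ?Z = "zariski_GL tuple_scale :: ((complex^'n^'n, 'm) vec \<Rightarrow> (complex^'n^'n, 'm) vec) topology"
  have "connected D"
    unfolding D_def by (rule connected_open_delete_finite) (simp_all add: finite_singular_segment convex_connected)
  have sym: "\<gamma> z \<in> symmetry_group tuple_scale SING" if "z \<in> D" for z
    unfolding \<gamma>_def by (rule tensor_action_symmetry) (use that in \<open>auto simp: D_def\<close>)
  then have GL: "\<gamma> z \<in> general_linear tuple_scale" if "z \<in> D" for z
    using that unfolding symmetry_group_def by blast
  have "continuous_map (top_of_set D) ?Z \<gamma>"
    unfolding continuous_map_closedin
  proof (intro conjI allI impI)
    show "\<gamma> \<in> topspace (top_of_set D) \<rightarrow> topspace ?Z"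
      using GL by (auto simp: topspace_zariski_GL)
    fix C assume "closedin ?Z C"
    then obtain F where F: "F \<subseteq> polynomial_functions_End tuple_scale"
        "C = {g \<in> general_linear tuple_scale. \<forall>f\<in>F. f g = 0}"
      unfolding closedin_zariski_GL zariski_closed_GL_def by blast
    have "closed {z. f (\<gamma> z) = 0}" if "f \<in> F" for f
      using that F(1) unfolding \<gamma>_def
      by (intro closed_Collect_eq continuous_on_polynomial_function continuous_on_tensor_segment
          continuous_on_const) blast
    then have "closed (\<Inter>f\<in>F. {z. f (\<gamma> z) = 0})" by blast
    moreover have "{z \<in> topspace (top_of_set D). \<gamma> z \<in> C} = D \<inter> (\<Inter>f\<in>F. {z. f (\<gamma> z) = 0})"
      using GL by (auto simp: F(2))
    ultimately show "closedin (top_of_set D) {z \<in> topspace (top_of_set D). \<gamma> z \<in> C}"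
      by (simp add: closedin_closed_Int)
  qed
  then have "connectedin ?Z (\<gamma> ` D)"
    by (rule connectedin_continuous_map_image) (simp add: connectedin_subtopology \<open>connected D\<close>)
  then have "connectedin (subtopology ?Z (symmetry_group tuple_scale SING)) (\<gamma> ` D)"
    using sym by (auto simp: connectedin_subtopology)
  moreover have "id \<in> \<gamma> ` D"
  proof (rule image_eqI)
    show "id = \<gamma> 0"
      by (rule ext) (simp add: \<gamma>_def segment_to_identity_0 tensor_action_id)
    show "0 \<in> D" by (simp add: D_def segment_to_identity_0 invertible_det_nz)
  qed
  moreover have "g \<in> \<gamma> ` D"
  proof (rule image_eqI)
    show "g = \<gamma> 1" by (simp add: \<gamma>_def segment_to_identity_1 g)
    show "1 \<in> D" by (simp add: D_def segment_to_identity_1 inv)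
  qed
  ultimately show ?thesis
    unfolding connected_symmetry_group_def mem_Collect_eq connected_component_of_def by blast
qed

section \<open>Separating the action group from its transposed coset\<close>

text \<open>The 2 by 2 minor, on columns \<open>s\<close> and \<open>s'\<close>, of the r-th rows of
  the i-th matrices of \<open>g X\<close> and \<open>g Y\<close>. The difference is written with the
  factor \<open>-1\<close> because polynomial functions are generated by constants, sums and
  products.\<close>

definition quadric :: "complex^'n^'n^'m \<Rightarrow> complex^'n^'n^'m \<Rightarrow> 'm \<Rightarrow> 'n \<Rightarrow> 'n \<Rightarrow> 'n \<Rightarrow>
    (complex^'n^'n^'m \<Rightarrow> complex^'n^'n^'m) \<Rightarrow> complex"
  where "quadric X Y i r s s' g =
    g X $ i $ r $ s * g Y $ i $ r $ s' + (-1) * (g X $ i $ r $ s' * g Y $ i $ r $ s)"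

lemma quadric_polynomial:
  fixes X Y :: "complex^'n^'n^'m"
  shows "quadric X Y i r s s' \<in> polynomial_functions_End tuple_scale"
proof -
  have "vector_space ((*) :: complex \<Rightarrow> complex \<Rightarrow> complex)"
    by unfold_locales (simp_all add: algebra_simps)
  then have "Vector_Spaces.linear tuple_scale (*) (\<lambda>X :: complex^'n^'n^'m. X $ i $ r $ s)" for i r s
    by (simp add: Vector_Spaces.linear_iff vector_space_tuple_scale tuple_scale_nth)
  from polynomial_functions_End.coeff[OF this]
  have c: "(\<lambda>g. g X $ i $ r $ s) \<in> polynomial_functions_End tuple_scale" for X :: "complex^'n^'n^'m" and i r s .
  show ?thesis unfolding quadric_def[abs_def]
    by (intro polynomial_functions_End.intros(1,3,4) c)
qed

lemma tensor_action_elementary: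
  "tensor_action P Q T (elementary c a b) $ i $ r $ s = (P *v c) $ i * Q $ r $ a * T $ b $ s"
proof -
  have "combination t (elementary c a b) = map_matrix ((*) (\<Sum>j\<in>UNIV. t $ j * c $ j)) (matrix_unit a b)" for t
    by (auto simp: vec_eq_iff combination_nth elementary_nth matrix_unit_nth intro!: sum.neutral)
  moreover have "(Q ** matrix_unit a b ** T) $ r $ s = Q $ r $ a * T $ b $ s"
  proof -
    have "(Q ** matrix_unit a b ** T) $ r $ s = (Q *v (matrix_unit a b *v (T *v axis s 1))) $ r"
      by (simp add: matrix_vector_mul_assoc matrix_vector_axis matrix_mul_assoc)
    also have "\<dots> = Q $ r $ a * T $ b $ s"
      by (simp add: matrix_unit_vector_mult matrix_vector_axis)
        (simp add: matrix_vector_mult_def axis_def if_distrib cong: if_cong)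
    finally show ?thesis .
  qed
  ultimately show ?thesis
    by (simp add: tensor_action_def scale_matrix_mult_left scale_matrix_mult_right matrix_vector_mult_def)
qed

text \<open>Both rows that enter the minor are multiples of row \<open>b\<close> of
  \<open>T\<close>.\<close>

lemma quadric_tensor_action_same_column:
  "quadric (elementary c a b) (elementary c a' b) i r s s' (tensor_action P Q T) = 0"
  by (simp add: quadric_def tensor_action_elementary)

text \<open>Here the minor is a square times a minor of the rows \<open>b\<close> and
  \<open>b'\<close> of \<open>T\<close>. The square can be made nonzero because \<open>P\<close> and
  \<open>Q\<close> have no zero column, the other factor because distinct rows of an invertible
  matrix are not proportional.\<close>

lemma quadric_tensor_action_same_row:
  fixes P :: "complex^'m^'m" and Q T :: "complex^'n^'n"
  assumes inv: "invertible P" "invertible Q" "invertible T" and ne: "b \<noteq> b'"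
  obtains c a i r s s' where
    "quadric (elementary c a b) (elementary c a b') i r s s' (tensor_action P Q T) \<noteq> 0"
proof -
  have "P *v axis k 1 \<noteq> 0" for k using invertible_mult_eq_0[OF inv(1)] by (metis axis_eq_0_iff zero_neq_one)
  then obtain k i where i: "(P *v axis k 1) $ i \<noteq> 0" by (metis vec_eq_iff zero_index)
  have "Q *v axis a 1 \<noteq> 0" for a using invertible_mult_eq_0[OF inv(2)] by (metis axis_eq_0_iff zero_neq_one)
  then obtain a r where r: "Q $ r $ a \<noteq> 0" by (metis vec_eq_iff zero_index matrix_vector_axis)
  have row: "axis j 1 v* T = T $ j" for j by (simp add: vec_eq_iff axis_vector_matrix)
  have Tb: "T $ b \<noteq> 0" using invertible_vector_mult_eq_0[OF inv(3)] row by (metis axis_eq_0_iff zero_neq_one)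
  have "\<exists>s s'. T $ b $ s * T $ b' $ s' \<noteq> T $ b $ s' * T $ b' $ s"
  proof (rule ccontr)
    assume "\<not> ?thesis"
    then obtain d where d: "T $ b' = d *s T $ b" using proportional_if_minors_0[OF Tb, of "T $ b'"] by blast
    have "(axis b' 1 - d *s axis b 1) v* T = axis b' 1 v* T - d *s (axis b 1 v* T)"
      by (simp add: vec_eq_iff vector_matrix_mult_def sum_subtractf sum_distrib_left algebra_simps)
    also have "\<dots> = 0" by (simp only: row d) simp
    finally have "axis b' 1 - d *s axis b 1 = (0 :: complex^'n)" by (rule invertible_vector_mult_eq_0[OF inv(3)])
    from arg_cong[OF this, of "\<lambda>x. x $ b'"] show False using ne by (simp add: axis_def)
  qed
  then obtain s s' where "T $ b $ s * T $ b' $ s' - T $ b $ s' * T $ b' $ s \<noteq> 0" by auto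
  then have "((P *v axis k 1) $ i * Q $ r $ a)^2 * (T $ b $ s * T $ b' $ s' - T $ b $ s' * T $ b' $ s) \<noteq> 0"
    using i r by simp
  also have "((P *v axis k 1) $ i * Q $ r $ a)^2 * (T $ b $ s * T $ b' $ s' - T $ b $ s' * T $ b' $ s) =
      quadric (elementary (axis k 1) a b) (elementary (axis k 1) a b') i r s s' (tensor_action P Q T)"
    by (simp add: quadric_def tensor_action_elementary algebra_simps power2_eq_square)
  finally show ?thesis by (rule that)
qed

text \<open>Such a \<open>g\<close> transposes before acting by a tensor action, so the conditions
  for a common column and for a common row change places.\<close>

lemma quadric_transpose:
  assumes "tuple_transpose \<circ> g = tensor_action P Q T"
  shows "quadric (elementary c a b) (elementary d a' b') i r s s' g =
    quadric (elementary c b a) (elementary d b' a') i r s s' (tensor_action P (transpose T) (transpose Q))"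
proof -
  have "g (elementary c a b) = tensor_action P (transpose T) (transpose Q) (elementary c b a)" for c a b
    using fun_cong[OF assms, of "elementary c a b", THEN arg_cong, of tuple_transpose]
    by (simp add: tuple_transpose_transpose tensor_action_transpose tuple_transpose_elementary)
  then show ?thesis by (simp add: quadric_def)
qed

lemma closedin_symmetry_group:
  assumes "F \<subseteq> polynomial_functions_End scl"
  shows "closedin (subtopology (zariski_GL scl) (symmetry_group scl S)) {g \<in> symmetry_group scl S. \<forall>f\<in>F. f g = 0}"
  unfolding closedin_subtopology closedin_zariski_GL
proof (intro exI conjI)
  show "zariski_closed_GL scl {g \<in> general_linear scl. \<forall>f\<in>F. f g = 0}"
    unfolding zariski_closed_GL_def using assms by blast
qed (auto simp: symmetry_group_def)

text \<open>The closed set \<open>E\<close> contains the action group and misses its transposed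
  coset, and \<open>E'\<close> does the opposite. As the two cosets exhaust the symmetries, a
  connected set containing \<open>id\<close> cannot reach a symmetry outside the action
  group.\<close>

lemma connected_symmetry_group_SING_subset:
  fixes g :: "complex^'n^'n^'m::{finite,linorder} \<Rightarrow> complex^'n^'n^'m::{finite,linorder}"
  assumes "g \<in> connected_symmetry_group tuple_scale SING"
  shows "g \<in> tuple_action_group"
proof (rule ccontr)
  assume gG: "g \<notin> tuple_action_group"
  let ?S = "symmetry_group tuple_scale (SING :: (complex^'n^'n, 'm) vec set)"
  let ?Z = "subtopology (zariski_GL tuple_scale) ?S"
  obtain C where C: "connectedin ?Z C" "id \<in> C" "g \<in> C"
    using assms unfolding connected_symmetry_group_def connected_component_of_def by blast
  have CS: "C \<subseteq> ?S" using C(1) connectedin_subset_topspace symmetry_group_topspace by blast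
  show False
  proof (cases "\<exists>b b' :: 'n. b \<noteq> b'")
    \<comment> \<open>For 1 by 1 matrices transposition is the identity, so both alternatives of
      \<open>symmetry_group_SING\<close> place \<open>g\<close> in the action group.\<close>
    case False
    have "tuple_transpose X = X" for X :: "(complex^'n^'n, 'm) vec"
      using False by (simp add: vec_eq_iff tuple_transpose_def transpose_def) metis
    then have "tuple_transpose \<circ> g = g" by (simp add: fun_eq_iff)
    then show False using symmetry_group_SING[of g] gG CS C(3) by auto
  next
    case True
    then obtain b b' :: 'n where b: "b \<noteq> b'" by blast
    define F where "F = {quadric (elementary c a d) (elementary c a' d) i r s s' :: ((complex^'n^'n, 'm) vec \<Rightarrow> _) \<Rightarrow> _ | c a a' d i r s s'. True}"
    define F' where "F' = {quadric (elementary c a d) (elementary c a d') i r s s' :: ((complex^'n^'n, 'm) vec \<Rightarrow> _) \<Rightarrow> _ | c a d d' i r s s'. True}"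
    define E where "E = {h \<in> ?S. \<forall>f\<in>F. f h = 0}"
    define E' where "E' = {h \<in> ?S. \<forall>f\<in>F'. f h = 0}"
    have "F \<subseteq> polynomial_functions_End tuple_scale" "F' \<subseteq> polynomial_functions_End tuple_scale"
      by (auto simp: F_def F'_def quadric_polynomial)
    then have closed: "closedin ?Z E" "closedin ?Z E'"
      unfolding E_def E'_def by (simp_all only: closedin_symmetry_group)
    have G: "h \<in> E \<and> h \<notin> E'" if hS: "h \<in> ?S" and hG: "h \<in> tuple_action_group" for h
    proof -
      obtain P Q T where h: "h = tensor_action P Q T" and inv: "invertible P" "invertible Q" "invertible T"
        using hG unfolding tuple_action_group_eq by blast
      have "f h = 0" if fF: "f \<in> F" for f
      proof -
        obtain c a a' d i r s s' where "f = quadric (elementary c a d) (elementary c a' d) i r s s'"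
          using fF unfolding F_def by blast
        then show ?thesis by (simp only: h quadric_tensor_action_same_column)
      qed
      then have "h \<in> E" using hS unfolding E_def by blast
      moreover have "h \<notin> E'"
      proof -
        obtain c a i r s s' where
          "quadric (elementary c a b) (elementary c a b') i r s s' h \<noteq> 0"
          unfolding h by (rule quadric_tensor_action_same_row[OF inv b])
        then show ?thesis unfolding E'_def F'_def by blast
      qed
      ultimately show ?thesis ..
    qed
    have G': "h \<in> E' \<and> h \<notin> E" if hS: "h \<in> ?S" and hG: "tuple_transpose \<circ> h \<in> tuple_action_group" for h
    proof -
      obtain P Q T where h: "tuple_transpose \<circ> h = tensor_action P Q T"
          and inv: "invertible P" "invertible Q" "invertible T"
        using hG unfolding tuple_action_group_eq by blast
      have inv': "invertible (transpose T)" "invertible (transpose Q)"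
        using inv by (simp_all add: invertible_det_nz det_transpose)
      have "f h = 0" if fF: "f \<in> F'" for f
      proof -
        obtain c a d d' i r s s' where "f = quadric (elementary c a d) (elementary c a d') i r s s'"
          using fF unfolding F'_def by blast
        then show ?thesis by (simp only: quadric_transpose[OF h] quadric_tensor_action_same_column)
      qed
      then have "h \<in> E'" using hS unfolding E'_def by blast
      moreover have "h \<notin> E"
      proof -
        obtain c a i r s s' where
          "quadric (elementary c a b) (elementary c a b') i r s s' (tensor_action P (transpose T) (transpose Q)) \<noteq> 0"
          by (rule quadric_tensor_action_same_row[OF inv(1) inv' b])
        then have "quadric (elementary c b a) (elementary c b' a) i r s s' h \<noteq> 0"
          by (simp only: quadric_transpose[OF h] not_False_eq_True)
        then show ?thesis unfolding E_def F_def by blast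
      qed
      ultimately show ?thesis ..
    qed
    have "id \<in> E \<and> id \<notin> E'"
    proof (rule G)
      show "id \<in> ?S" using C(2) CS by blast
      have "id = (tensor_action (mat 1) (mat 1) (mat 1) :: (complex^'n^'n, 'm) vec \<Rightarrow> _)"
        by (rule ext) (simp add: tensor_action_id)
      then show "(id :: (complex^'n^'n, 'm) vec \<Rightarrow> _) \<in> tuple_action_group"
        unfolding tuple_action_group_eq mem_Collect_eq
        by (intro exI[of _ "mat 1"]) (simp add: invertible_det_nz)
    qed
    moreover have "g \<in> E'" using G'[of g] symmetry_group_SING[of g] gG C(3) CS by blast
    moreover have "C \<subseteq> E \<union> E'" using G G' symmetry_group_SING CS by blast
    moreover have "E \<inter> E' \<inter> C = {}" using G G' symmetry_group_SING CS by blast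
    ultimately show False using C closed unfolding connectedin_closedin by blast
  qed
qed

theorem theorem1p11:
  shows "connected_symmetry_group tuple_scale
      (SING :: (complex^'n^'n^'m::{finite,linorder}) set) = tuple_action_group"
  using tuple_action_group_connected connected_symmetry_group_SING_subset by blast

end
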